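(* For every real $r$ there exist constants $C_1,C_2>0$, depending only on $r$, such that the following holds for all integers $d\ge 2$, $D\ge 1$, $1\le l\le n$ satisfying $$n\geq 2\frac{\log D}{\log d}+l .$$ Let $|\psi\rangle$ be a random matrix product state drawn from $\mu_{d,n,D}$, let $A$ be a set of $l$ consecutive qudits, and let $\rho_A'$ be the reduced density matrix on $A$ of the normalized state $|\psi\rangle\langle\psi|/\langle\psi|\psi\rangle$. Then $$\mathrm{Pr}\left(\mathrm{Tr}[\rho_A'^2]\geq C_1D^{-r}+d^{-l}\right)\leq C_2\,D^{-(2-r)}.$$
   Context: Random matrix product state (RMPS) with periodic boundary conditions, local dimension $d$, system size $n\ge 1$, bond dimension $D$: draw $U^{(1)},\dots,U^{(n)}$ independently from the Haar measure on the unitary group $U(dD)$ acting on $\mathbb{C}^d\otimes\mathbb{C}^D$. Fix an orthonormal basis $|0\rangle,\dots,|d-1\rangle$ of $\mathbb{C}^d$ and define the $D\times D$ matrices $A^{(j)}_i:=(\langle i|\otimes \mathbb{1}_D)\,U^{(j)}\,(|0\rangle\otimes \mathbb{1}_D)$ for $0\le i\le d-1$. The RMPS is the (in general unnormalized, almost surely nonzero) vector $$|\psi\rangle=\sum_{i_1,\dots,i_n=0}^{d-1}\mathrm{Tr}\left[A^{(1)}_{i_1}A^{(2)}_{i_2}\cdots A^{(n)}_{i_n}\right]|i_1,\dots,i_n\rangle\in(\mathbb{C}^d)^{\otimes n}.$$ Its distribution is denoted $\mu_{d,n,D}$. The qudits are the $n$ tensor factors $\mathbb{C}^d$, labelled $1,\dots,n$.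 *)

theory Defs
  imports "HOL-Probability.Probability" "Jordan_Normal_Form.Schur_Decomposition"
begin

definition mat_trace :: "complex mat \<Rightarrow> complex" where
  "mat_trace A = (\<Sum>k<dim_row A. A $$ (k, k))"

definition unitary_group :: "nat \<Rightarrow> complex mat set" where
  "unitary_group N =
     {U \<in> carrier_mat N N. mat_adjoint U * U = 1\<^sub>m N \<and> U * mat_adjoint U = 1\<^sub>m N}"

(* The sigma-algebra generated by the matrix entries is the Borel sigma-algebra of the
   N^2-dimensional space of matrices; it is then restricted to the unitary group. *)
definition unitary_borel :: "nat \<Rightarrow> complex mat measure" where
  "unitary_borel N =
     restrict_space
       (vimage_algebra (carrier_mat N N) (\<lambda>A. \<lambda>p\<in>{..<N} \<times> {..<N}. A $$ p)
          (Pi\<^sub>M ({..<N} \<times> {..<N}) (\<lambda>_. borel)))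
       (unitary_group N)"

(* Exactly one measure satisfies this predicate for each N, namely normalised Haar measure. *)
definition haar_unitary :: "nat \<Rightarrow> complex mat measure \<Rightarrow> bool" where
  "haar_unitary N H \<longleftrightarrow>
     prob_space H \<and> sets H = sets (unitary_borel N) \<and>
     (\<forall>V\<in>unitary_group N. distr H H (\<lambda>U. V * U) = H \<and> distr H H (\<lambda>U. U * V) = H)"

(* Basis labels of the qudits in S, each of local dimension d. A vector of the tensor product
   over S is its family of amplitudes on these labels; an operator is its matrix. *)
definition configs :: "nat \<Rightarrow> nat set \<Rightarrow> (nat \<Rightarrow> nat) set" where
  "configs d S = S \<rightarrow>\<^sub>E {..<d}"

(* The basis vector |i> tensor |k> of C^d tensor C^D has index i * D + k, so this is the block
   of U with block row i and block column 0. *)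
definition mps_block :: "nat \<Rightarrow> complex mat \<Rightarrow> nat \<Rightarrow> complex mat" where
  "mps_block D U i = mat D D (\<lambda>(k, m). U $$ (i * D + k, 0 * D + m))"

(* Sites are numbered 0, ..., n - 1. *)
definition mps_state ::
  "nat \<Rightarrow> nat \<Rightarrow> nat \<Rightarrow> (nat \<Rightarrow> complex mat) \<Rightarrow> (nat \<Rightarrow> nat) \<Rightarrow> complex" where
  "mps_state d n D U =
     (\<lambda>x\<in>configs d {..<n}.
        mat_trace (foldr (*) (map (\<lambda>j. mps_block D (U j) (x j)) [0..<n]) (1\<^sub>m D)))"

(* The law of the random matrix product state when H is Haar measure on U(d D). *)
definition rmps :: "complex mat measure \<Rightarrow> nat \<Rightarrow> nat \<Rightarrow> nat \<Rightarrow> ((nat \<Rightarrow> nat) \<Rightarrow> complex) measure" where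
  "rmps H d n D =
     distr (Pi\<^sub>M {..<n} (\<lambda>_. H)) (Pi\<^sub>M (configs d {..<n}) (\<lambda>_. borel)) (mps_state d n D)"

definition sq_norm_state :: "nat \<Rightarrow> nat \<Rightarrow> ((nat \<Rightarrow> nat) \<Rightarrow> complex) \<Rightarrow> complex" where
  "sq_norm_state d n \<psi> = (\<Sum>x\<in>configs d {..<n}. cnj (\<psi> x) * \<psi> x)"

definition normalized_density ::
  "nat \<Rightarrow> nat \<Rightarrow> ((nat \<Rightarrow> nat) \<Rightarrow> complex) \<Rightarrow> (nat \<Rightarrow> nat) \<Rightarrow> (nat \<Rightarrow> nat) \<Rightarrow> complex" where
  "normalized_density d n \<psi> x y = \<psi> x * cnj (\<psi> y) / sq_norm_state d n \<psi>"

(* Partial trace over the sites outside A; merge glues a label on A and one on the rest. *)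
definition reduced_op ::
  "nat \<Rightarrow> nat \<Rightarrow> nat set \<Rightarrow> ((nat \<Rightarrow> nat) \<Rightarrow> (nat \<Rightarrow> nat) \<Rightarrow> complex) \<Rightarrow>
     (nat \<Rightarrow> nat) \<Rightarrow> (nat \<Rightarrow> nat) \<Rightarrow> complex" where
  "reduced_op d n A \<rho> x y =
     (let B = {..<n} - A in \<Sum>z\<in>configs d B. \<rho> (merge A B (x, z)) (merge A B (y, z)))"

(* The trace of the square of an operator on the sites in A. *)
definition trace_square ::
  "nat \<Rightarrow> nat set \<Rightarrow> ((nat \<Rightarrow> nat) \<Rightarrow> (nat \<Rightarrow> nat) \<Rightarrow> complex) \<Rightarrow> complex" where
  "trace_square d A \<rho> = (\<Sum>x\<in>configs d A. \<Sum>y\<in>configs d A. \<rho> x y * \<rho> y x)"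

(* The value is real because the reduced density matrix is Hermitian. *)
definition reduced_purity :: "nat \<Rightarrow> nat \<Rightarrow> nat set \<Rightarrow> ((nat \<Rightarrow> nat) \<Rightarrow> complex) \<Rightarrow> real" where
  "reduced_purity d n A \<psi> = Re (trace_square d A (reduced_op d n A (normalized_density d n \<psi>)))"

(* Periodic boundary conditions: a run of sites may wrap around from n - 1 to 0. *)
definition consecutive_sites :: "nat \<Rightarrow> nat \<Rightarrow> nat set \<Rightarrow> bool" where
  "consecutive_sites n l A \<longleftrightarrow> (\<exists>a<n. A = (\<lambda>k. (a + k) mod n) ` {..<l})"

end

(*
Write N = <psi|psi> and let P be the unnormalised purity of A, so that the purity of rho'_A is P / N^2.
Both N and P are polynomials in the blocks, i.e. sums over closed paths of bond indices of products over
the sites. Since the sites are independent, the expectation factorises site by site, and the second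
moments of Haar measure (which left invariance determines completely) turn E P into the trace of a product
of 2 x 2 transfer matrices with eigenvalues 1 and x = d (D^2 - 1) / (d^2 D^2 - 1) <= 1/d. This gives
E N = 1, E N^2 = 1 + x^n (the case of empty A) and, with t = D^2 (d + 1)^2 / (d D^2 + 1)^2 <= 4 / D^2,
E P = t + (1 - t) (x^l + x^(n-l)) + t x^n. As n - l >= 2 log D / log d, both Var N and
E (P - d^(-l) N^2) are O(D^(-2)), and P - d^(-l) N^2 >= 0 by Cauchy-Schwarz. If N > 1/2, a purity of at
least D^(-r) + d^(-l) forces P - d^(-l) N^2 >= D^(-r) / 4, so Chebyshev's inequality for N and Markov's
for P - d^(-l) N^2 give the bound when r >= 0. For r < 0 the event is empty, because the purity is at most 1.
*)
theory Submission
  imports Defs "HOL-Number_Theory.Cong"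
begin

section \<open>Sums over closed paths\<close>

text \<open>\<open>cyclic_sum\<close> is the trace of an ordered product of matrices spelled out
  over indices. In this form the index set may consist of tuples of bond indices, products of traces
  stay traces, and independence moves the expectation inside. The averaged kernel of a site in two
  replicas acts on D^4 index tuples, but it factors through the two ways of pairing kets with bras,
  hence has rank at most 2; cyclicity then trades the tuples for the index set {0, 1}. The second
  moments are found without representation theory, from three kinds of explicit unitaries (a phase
  in one row, an exchange of rows, one rational reflection) and the orthonormality of columns. Sites
  inside and outside A give transfer matrices that differ by exchanging the two basis vectors; as A
  is a single run, they meet only through the overlap t of their leading eigenprojections. Markov's
  inequality for P itself would be too weak, because E P contains the term x^l; since x <= 1/d,
  subtracting d^(-l) N^2 removes it while keeping the variable nonnegative.\<close>

definition cyclic_sum :: "nat \<Rightarrow> 'a set \<Rightarrow> (nat \<Rightarrow> 'a \<Rightarrow> 'a \<Rightarrow> 'b) \<Rightarrow> 'b::comm_semiring_1" where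
  "cyclic_sum n E K = (\<Sum>k\<in>{..<n} \<rightarrow>\<^sub>E E. \<Prod>j<n. K j (k j) (k (Suc j mod n)))"

lemma cyclic_sum_cong:
  assumes "\<And>j p q. j < n \<Longrightarrow> p \<in> E \<Longrightarrow> q \<in> E \<Longrightarrow> K j p q = L j p q"
  shows "cyclic_sum n E K = cyclic_sum n E L"
  unfolding cyclic_sum_def
proof (intro sum.cong refl prod.cong)
  fix k j assume "k \<in> {..<n} \<rightarrow>\<^sub>E E" "j \<in> {..<n}"
  moreover from this have "Suc j mod n < n" by (intro mod_less_divisor) auto
  ultimately show "K j (k j) (k (Suc j mod n)) = L j (k j) (k (Suc j mod n))"
    by (intro assms) (auto simp: PiE_iff)
qed

lemma bij_betw_add_mod:
  assumes "0 < n"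
  shows "bij_betw (\<lambda>j. (a + j) mod n) {..<n} {..<n::nat}"
proof -
  have "inj_on (\<lambda>j. (a + j) mod n) {..<n}"
  proof (rule inj_onI)
    fix i j assume ij: "i \<in> {..<n}" "j \<in> {..<n}" "(a + i) mod n = (a + j) mod n"
    then have "[a + i = a + j] (mod n)" by (simp add: cong_def)
    then have "[i = j] (mod n)" by (simp add: cong_add_lcancel_nat)
    then show "i = j" using ij by (simp add: cong_def)
  qed
  moreover have "(\<lambda>j. (a + j) mod n) ` {..<n} \<subseteq> {..<n}" using assms by auto
  ultimately show ?thesis
    by (metis bij_betw_def card_image card_subset_eq finite_lessThan)
qed

lemma bij_betw_Suc_mod: "0 < n \<Longrightarrow> bij_betw (\<lambda>j. Suc j mod n) {..<n} {..<n}"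
  using bij_betw_add_mod[of n 1] by simp

lemma prod_Suc_mod: "0 < n \<Longrightarrow> (\<Prod>j<n. g (Suc j mod n)) = (\<Prod>j<n. g j)"
  by (rule prod.reindex_bij_betw[OF bij_betw_Suc_mod])

text \<open>Each factor reads a single coordinate of \<open>k\<close>, and the cyclic shift of the
  sites is a bijection, so reindexing by its inverse \<open>t\<close> reduces the claim to
  distributivity.\<close>

lemma sum_PiE_prod_Suc_mod:
  fixes h :: "nat \<Rightarrow> 'a \<Rightarrow> 'b::comm_semiring_1"
  assumes "0 < n" "finite E"
  shows "(\<Sum>k\<in>{..<n} \<rightarrow>\<^sub>E E. \<Prod>j<n. h j (k (Suc j mod n))) = (\<Prod>j<n. \<Sum>x\<in>E. h j x)"
proof -
  define s where "s = (\<lambda>j. Suc j mod n)"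
  define t where "t = inv_into {..<n} s"
  have b: "bij_betw s {..<n} {..<n}" unfolding s_def by (rule bij_betw_Suc_mod[OF assms(1)])
  then have bt: "bij_betw t {..<n} {..<n}" unfolding t_def by (rule bij_betw_inv_into)
  have st: "s (t i) = i" if "i < n" for i
    using bij_betw_inv_into_right[OF b] that by (simp add: t_def)
  have "(\<Prod>j<n. h j (k (s j))) = (\<Prod>i<n. h (t i) (k i))" for k
    using prod.reindex_bij_betw[OF bt, of "\<lambda>j. h j (k (s j))"] st by simp
  then have "(\<Sum>k\<in>{..<n} \<rightarrow>\<^sub>E E. \<Prod>j<n. h j (k (s j)))
      = (\<Sum>k\<in>{..<n} \<rightarrow>\<^sub>E E. \<Prod>i<n. h (t i) (k i))" by simp
  also have "\<dots> = (\<Prod>i<n. \<Sum>x\<in>E. h (t i) x)"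
    using assms by (intro prod_sum_PiE[symmetric]) auto
  also have "\<dots> = (\<Prod>j<n. \<Sum>x\<in>E. h j x)"
    by (rule prod.reindex_bij_betw[OF bt])
  finally show ?thesis by (simp add: s_def)
qed

text \<open>The analogue for closed paths of the cyclicity of the trace.\<close>

lemma cyclic_sum_factor:
  assumes "0 < n" "finite E" "finite S"
  shows "cyclic_sum n E (\<lambda>j p q. \<Sum>s\<in>S. L j p s * R j s q)
       = cyclic_sum n S (\<lambda>j s t. \<Sum>x\<in>E. R j s x * L (Suc j mod n) x t)"
proof -
  have "cyclic_sum n E (\<lambda>j p q. \<Sum>s\<in>S. L j p s * R j s q)
     = (\<Sum>k\<in>{..<n} \<rightarrow>\<^sub>E E. \<Sum>\<sigma>\<in>{..<n} \<rightarrow>\<^sub>E S. \<Prod>j<n. L j (k j) (\<sigma> j) * R j (\<sigma> j) (k (Suc j mod n)))"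
    unfolding cyclic_sum_def using assms by (intro sum.cong refl prod_sum_PiE) auto
  also have "\<dots> = (\<Sum>\<sigma>\<in>{..<n} \<rightarrow>\<^sub>E S. \<Sum>k\<in>{..<n} \<rightarrow>\<^sub>E E.
        \<Prod>j<n. L j (k j) (\<sigma> j) * R j (\<sigma> j) (k (Suc j mod n)))"
    by (rule sum.swap)
  \<comment> \<open>The factor \<open>L\<close> of site j + 1 is grouped with \<open>R\<close> of
    site j (modulo n), so that each bond index \<open>k (Suc j mod n)\<close> occurs in exactly one
    factor and can be summed there.\<close>
  also have "\<dots> = (\<Sum>\<sigma>\<in>{..<n} \<rightarrow>\<^sub>E S. \<Sum>k\<in>{..<n} \<rightarrow>\<^sub>E E.
        \<Prod>j<n. R j (\<sigma> j) (k (Suc j mod n)) * L (Suc j mod n) (k (Suc j mod n)) (\<sigma> (Suc j mod n)))"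
  proof (intro sum.cong refl)
    fix \<sigma> k
    show "(\<Prod>j<n. L j (k j) (\<sigma> j) * R j (\<sigma> j) (k (Suc j mod n)))
      = (\<Prod>j<n. R j (\<sigma> j) (k (Suc j mod n)) * L (Suc j mod n) (k (Suc j mod n)) (\<sigma> (Suc j mod n)))"
      using prod_Suc_mod[OF assms(1), of "\<lambda>j. L j (k j) (\<sigma> j)"]
      by (simp add: prod.distrib mult.commute)
  qed
  also have "\<dots> = cyclic_sum n S (\<lambda>j s t. \<Sum>x\<in>E. R j s x * L (Suc j mod n) x t)"
    unfolding cyclic_sum_def
    by (intro sum.cong refl
        sum_PiE_prod_Suc_mod[OF assms(1,2), of "\<lambda>j x. R j (\<sigma> j) x * L (Suc j mod n) x (\<sigma> (Suc j mod n))" for \<sigma>])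
  finally show ?thesis .
qed

text \<open>One step is \<open>cyclic_sum_factor\<close> with a Kronecker delta as right factor: the
  kernel reappears one site earlier. It serves to move the first site of a run, possibly a wrapped
  one, to 0.\<close>

lemma cyclic_sum_rotate:
  assumes "0 < n" "finite E"
  shows "cyclic_sum n E (\<lambda>j. K ((a + j) mod n)) = cyclic_sum n E K"
proof (induction a)
  case 0
  show ?case by (rule cyclic_sum_cong) simp
next
  case (Suc a)
  let ?K = "\<lambda>j. K ((a + j) mod n)"
  have "cyclic_sum n E ?K = cyclic_sum n E (\<lambda>j p q. \<Sum>s\<in>E. ?K j p s * of_bool (s = q))"
    using assms by (intro cyclic_sum_cong) simp
  also have "\<dots> = cyclic_sum n E (\<lambda>j s t. \<Sum>x\<in>E. of_bool (s = x) * ?K (Suc j mod n) x t)"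
    by (rule cyclic_sum_factor[OF assms assms(2)])
  also have "\<dots> = cyclic_sum n E (\<lambda>j. K ((Suc a + j) mod n))"
    using assms by (intro cyclic_sum_cong) (simp add: mod_add_right_eq)
  finally show ?case using Suc.IH by simp
qed

lemma restrict_eq_PiE:
  assumes "f \<in> Pi\<^sub>E A B" "\<And>j. j \<in> A \<Longrightarrow> g j = f j"
  shows "restrict g A = f"
proof
  fix j show "restrict g A j = f j"
    using assms(2)[of j] PiE_arb[OF assms(1), of j] by (cases "j \<in> A") simp_all
qed

text \<open>The trace of a tensor product: a pair of closed paths is a closed path of pairs.
  Repeated use turns a product of four amplitudes into one closed sum, which is why bond indices
  later are tuples nested to the left.\<close>

lemma cyclic_sum_mult:
  fixes K :: "nat \<Rightarrow> 'a \<Rightarrow> 'a \<Rightarrow> 'b::comm_semiring_1" and L :: "nat \<Rightarrow> 'c \<Rightarrow> 'c \<Rightarrow> 'b"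
  shows "cyclic_sum n E K * cyclic_sum n F L
    = cyclic_sum n (E \<times> F) (\<lambda>j p q. K j (fst p) (fst q) * L j (snd p) (snd q))"
proof -
  have "cyclic_sum n E K * cyclic_sum n F L
    = (\<Sum>z\<in>({..<n} \<rightarrow>\<^sub>E E) \<times> ({..<n} \<rightarrow>\<^sub>E F).
        \<Prod>j<n. K j (fst z j) (fst z (Suc j mod n)) * L j (snd z j) (snd z (Suc j mod n)))"
    unfolding cyclic_sum_def sum_product sum.cartesian_product
    by (simp add: prod.distrib case_prod_beta)
  also have "\<dots> = (\<Sum>k\<in>{..<n} \<rightarrow>\<^sub>E (E \<times> F).
        \<Prod>j<n. K j (fst (k j)) (fst (k (Suc j mod n))) * L j (snd (k j)) (snd (k (Suc j mod n))))"
  proof -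
    define i where "i = (\<lambda>k::nat \<Rightarrow> 'a \<times> 'c. (\<lambda>j\<in>{..<n}. fst (k j), \<lambda>j\<in>{..<n}. snd (k j)))"
    define w where "w = (\<lambda>z. \<lambda>j\<in>{..<n}. (fst z j :: 'a, snd z j :: 'c))"
    have 1: "i (w (f, g)) = (f, g)" if "f \<in> {..<n} \<rightarrow>\<^sub>E E" "g \<in> {..<n} \<rightarrow>\<^sub>E F" for f g
      unfolding i_def w_def prod.inject using that
      by (intro conjI) (erule restrict_eq_PiE, simp)+
    have 2: "w (f, g) \<in> {..<n} \<rightarrow>\<^sub>E (E \<times> F)"
      if "f \<in> {..<n} \<rightarrow>\<^sub>E E" "g \<in> {..<n} \<rightarrow>\<^sub>E F" for f g
      unfolding w_def using PiE_mem[OF that(1)] PiE_mem[OF that(2)] by (simp add: restrict_PiE_iff)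
    have 3: "w (i k) = k" if "k \<in> {..<n} \<rightarrow>\<^sub>E (E \<times> F)" for k
      unfolding i_def w_def by (rule restrict_eq_PiE[OF that]) simp
    have 4: "i k \<in> ({..<n} \<rightarrow>\<^sub>E E) \<times> ({..<n} \<rightarrow>\<^sub>E F)" if "k \<in> {..<n} \<rightarrow>\<^sub>E (E \<times> F)" for k
      using PiE_mem[OF that] unfolding i_def by (simp add: restrict_PiE_iff mem_Times_iff)
    have "bij_betw i ({..<n} \<rightarrow>\<^sub>E (E \<times> F)) (({..<n} \<rightarrow>\<^sub>E E) \<times> ({..<n} \<rightarrow>\<^sub>E F))"
    proof (rule bij_betw_byWitness[where f' = w])
      show "\<forall>k\<in>{..<n} \<rightarrow>\<^sub>E E \<times> F. w (i k) = k" using 3 by blast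
      show "\<forall>z\<in>({..<n} \<rightarrow>\<^sub>E E) \<times> ({..<n} \<rightarrow>\<^sub>E F). i (w z) = z" using 1 by blast
      show "i ` ({..<n} \<rightarrow>\<^sub>E E \<times> F) \<subseteq> ({..<n} \<rightarrow>\<^sub>E E) \<times> ({..<n} \<rightarrow>\<^sub>E F)" using 4 by blast
      show "w ` (({..<n} \<rightarrow>\<^sub>E E) \<times> ({..<n} \<rightarrow>\<^sub>E F)) \<subseteq> {..<n} \<rightarrow>\<^sub>E E \<times> F" using 2 by blast
    qed
    then have "(\<Sum>z\<in>({..<n} \<rightarrow>\<^sub>E E) \<times> ({..<n} \<rightarrow>\<^sub>E F). 
        \<Prod>j<n. K j (fst z j) (fst z (Suc j mod n)) * L j (snd z j) (snd z (Suc j mod n)))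
      = (\<Sum>k\<in>{..<n} \<rightarrow>\<^sub>E (E \<times> F).
        \<Prod>j<n. K j (fst (i k) j) (fst (i k) (Suc j mod n)) * L j (snd (i k) j) (snd (i k) (Suc j mod n)))"
      by (rule sum.reindex_bij_betw[symmetric])
    also have "\<dots> = (\<Sum>k\<in>{..<n} \<rightarrow>\<^sub>E (E \<times> F).
        \<Prod>j<n. K j (fst (k j)) (fst (k (Suc j mod n))) * L j (snd (k j)) (snd (k (Suc j mod n))))"
      unfolding i_def by (intro sum.cong prod.cong refl) simp
    finally show ?thesis .
  qed
  finally show ?thesis unfolding cyclic_sum_def .
qed

lemma cnj_cyclic_sum: "cnj (cyclic_sum n E K) = cyclic_sum n E (\<lambda>j p q. cnj (K j p q))"
  by (simp add: cyclic_sum_def)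

text \<open>Each label \<open>x j\<close> enters one factor only, so the sum over physical labels
  can be done inside the kernel of its site.\<close>

lemma sum_PiE_cyclic_sum:
  assumes "finite X"
  shows "(\<Sum>x\<in>{..<n} \<rightarrow>\<^sub>E X. cyclic_sum n E (\<lambda>j. K j (x j)))
    = cyclic_sum n E (\<lambda>j p q. \<Sum>a\<in>X. K j a p q)"
proof -
  have "(\<Sum>x\<in>{..<n} \<rightarrow>\<^sub>E X. cyclic_sum n E (\<lambda>j. K j (x j)))
    = (\<Sum>k\<in>{..<n} \<rightarrow>\<^sub>E E. \<Sum>x\<in>{..<n} \<rightarrow>\<^sub>E X. \<Prod>j<n. K j (x j) (k j) (k (Suc j mod n)))"
    unfolding cyclic_sum_def by (rule sum.swap)
  also have "\<dots> = cyclic_sum n E (\<lambda>j p q. \<Sum>a\<in>X. K j a p q)"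
    unfolding cyclic_sum_def
    using assms by (intro sum.cong refl prod_sum_PiE[symmetric]) auto
  finally show ?thesis .
qed

lemma sum_PiE_lessThan_Suc:
  assumes "finite E"
  shows "(\<Sum>k\<in>{..<Suc m} \<rightarrow>\<^sub>E E. f k) = (\<Sum>k\<in>{..<m} \<rightarrow>\<^sub>E E. \<Sum>x\<in>E. f (k(m := x)))"
proof -
  have inj: "inj_on (\<lambda>(y, g). g(m := y)) (E \<times> ({..<m} \<rightarrow>\<^sub>E E))"
    by (rule inj_combinator) simp
  have "(\<Sum>k\<in>{..<Suc m} \<rightarrow>\<^sub>E E. f k) = (\<Sum>(x, k)\<in>E \<times> ({..<m} \<rightarrow>\<^sub>E E). f (k(m := x)))"
    unfolding lessThan_Suc PiE_insert_eq by (subst sum.reindex[OF inj]) (auto simp: case_prod_beta)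
  also have "\<dots> = (\<Sum>k\<in>{..<m} \<rightarrow>\<^sub>E E. \<Sum>x\<in>E. f (k(m := x)))"
    by (subst sum.swap) (simp add: sum.cartesian_product)
  finally show ?thesis .
qed

text \<open>The last index occurs only in the last two factors, so summing over it multiplies these
  two matrices and shortens the path by one site.\<close>

lemma cyclic_sum_merge:
  fixes K :: "nat \<Rightarrow> 'a \<Rightarrow> 'a \<Rightarrow> 'b::comm_semiring_1"
  assumes "finite E"
  shows "cyclic_sum (Suc (Suc n)) E K
    = cyclic_sum (Suc n) E (\<lambda>j p q. if j = n then \<Sum>x\<in>E. K n p x * K (Suc n) x q else K j p q)"
  unfolding cyclic_sum_def sum_PiE_lessThan_Suc[OF assms, of f "Suc n" for f]
proof (intro sum.cong refl)
  fix k :: "nat \<Rightarrow> 'a"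
  have "(\<Sum>x\<in>E. \<Prod>j<Suc (Suc n). K j ((k(Suc n := x)) j) ((k(Suc n := x)) (Suc j mod Suc (Suc n))))
      = (\<Sum>x\<in>E. (\<Prod>j<n. K j (k j) (k (Suc j))) * (K n (k n) x * K (Suc n) x (k 0)))"
    by (intro sum.cong refl) (simp add: prod.lessThan_Suc mult.assoc)
  also have "\<dots> = (\<Prod>j<n. K j (k j) (k (Suc j))) * (\<Sum>x\<in>E. K n (k n) x * K (Suc n) x (k 0))"
    by (simp add: sum_distrib_left)
  also have "\<dots> = (\<Prod>j<Suc n. (if j = n then \<Sum>x\<in>E. K n (k j) x * K (Suc n) x (k (Suc j mod Suc n))
        else K j (k j) (k (Suc j mod Suc n))))"
    by (simp add: prod.lessThan_Suc)
  finally show "(\<Sum>x\<in>E. \<Prod>j<Suc (Suc n). K j ((k(Suc n := x)) j) ((k(Suc n := x)) (Suc j mod Suc (Suc n))))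
    = (\<Prod>j<Suc n. (if j = n then \<Sum>x\<in>E. K n (k j) x * K (Suc n) x (k (Suc j mod Suc n))
        else K j (k j) (k (Suc j mod Suc n))))" .
qed

text \<open>Induction on the number of sites, multiplying the last two matrices together. Positivity
  of \<open>n\<close> matters: for no sites the trace is \<open>D\<close>, whereas the closed sum is
  1.\<close>

lemma mat_trace_foldr:
  assumes "0 < n" "\<And>j. j < n \<Longrightarrow> A j \<in> carrier_mat D D"
  shows "mat_trace (foldr (*) (map A [0..<n]) (1\<^sub>m D)) = cyclic_sum n {..<D} (\<lambda>j p q. A j $$ (p, q))"
proof -
  have "(\<And>j. j < Suc m \<Longrightarrow> A j \<in> carrier_mat D D) \<Longrightarrow>
      mat_trace (foldr (*) (map A [0..<Suc m]) (1\<^sub>m D)) = cyclic_sum (Suc m) {..<D} (\<lambda>j p q. A j $$ (p, q))" for m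
  proof (induction m arbitrary: A)
    case 0
    then have "A 0 \<in> carrier_mat D D" by simp
    then show ?case
      by (simp add: cyclic_sum_def sum_PiE_lessThan_Suc mat_trace_def)
  next
    case (Suc m)
    define A' where "A' = (\<lambda>j. if j = m then A m * A (Suc m) else A j)"
    have c: "A m \<in> carrier_mat D D" "A (Suc m) \<in> carrier_mat D D" using Suc.prems by auto
    have c': "A m * A (Suc m) \<in> carrier_mat D D" using c by (rule mult_carrier_mat)
    have "map A' [0..<Suc m] = map A [0..<m] @ [A m * A (Suc m)]" by (simp add: A'_def)
    then have "foldr (*) (map A' [0..<Suc m]) (1\<^sub>m D) = foldr (*) (map A [0..<m]) (A m * A (Suc m))"
      using c by (simp only:) simp
    moreover have "foldr (*) (map A [0..<Suc (Suc m)]) (1\<^sub>m D) = foldr (*) (map A [0..<m]) (A m * A (Suc m))"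
      using c by simp
    ultimately have "foldr (*) (map A [0..<Suc (Suc m)]) (1\<^sub>m D) = foldr (*) (map A' [0..<Suc m]) (1\<^sub>m D)"
      by simp
    also have "mat_trace \<dots> = cyclic_sum (Suc m) {..<D} (\<lambda>j p q. A' j $$ (p, q))"
      using Suc.prems c' by (intro Suc.IH) (auto simp: A'_def)
    also have "\<dots> = cyclic_sum (Suc (Suc m)) {..<D} (\<lambda>j p q. A j $$ (p, q))"
      unfolding cyclic_sum_merge[OF finite_lessThan]
      using c by (intro cyclic_sum_cong) (auto simp: A'_def scalar_prod_def atLeast0LessThan)
    finally show ?case .
  qed
  then show ?thesis using assms by (cases n) auto
qed

section \<open>Second moments of Haar measure\<close>

lemma unitary_group_carrier: "U \<in> unitary_group N \<Longrightarrow> U \<in> carrier_mat N N"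
  by (simp add: unitary_group_def)

lemma mat_adjoint_carrier: "U \<in> carrier_mat N M \<Longrightarrow> mat_adjoint U \<in> carrier_mat M N"
  by (auto simp: mat_adjoint_def)

lemma mat_adjoint_index:
  assumes "U \<in> carrier_mat N N" "p < N" "q < N"
  shows "mat_adjoint U $$ (p, q) = cnj (U $$ (q, p))"
  using assms by (simp add: mat_adjoint_def mat_of_rows_def)

lemma unitary_columns:
  assumes U: "U \<in> unitary_group N" and "m < N" "s < N"
  shows "(\<Sum>p<N. U $$ (p, m) * cnj (U $$ (p, s))) = of_bool (m = s)"
proof -
  have c: "U \<in> carrier_mat N N" using U by (rule unitary_group_carrier)
  have "mat_adjoint U \<in> carrier_mat N N" using c by (rule mat_adjoint_carrier)
  then have "(mat_adjoint U * U) $$ (s, m) = (\<Sum>p<N. cnj (U $$ (p, s)) * U $$ (p, m))"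
    using c assms(2,3) by (simp add: scalar_prod_def atLeast0LessThan mat_adjoint_index)
  moreover have "(mat_adjoint U * U) $$ (s, m) = of_bool (m = s)"
    using U assms(2,3) by (auto simp: unitary_group_def)
  ultimately show ?thesis by (simp add: mult.commute)
qed

lemma unitary_entry_le_1:
  assumes "U \<in> unitary_group N" "p < N" "m < N"
  shows "norm (U $$ (p, m)) \<le> 1"
proof -
  have "complex_of_real (\<Sum>p<N. (norm (U $$ (p, m)))\<^sup>2) = 1"
    using unitary_columns[OF assms(1,3,3)] by (simp only: of_real_sum complex_norm_square) simp
  then have "(\<Sum>p<N. (norm (U $$ (p, m)))\<^sup>2) = 1" using of_real_eq_1_iff by blast
  moreover have "(norm (U $$ (p, m)))\<^sup>2 \<le> (\<Sum>p<N. (norm (U $$ (p, m)))\<^sup>2)"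
    using assms(2) by (intro member_le_sum) auto
  ultimately show ?thesis by (simp add: power_le_one_iff)
qed

section \<open>Explicit unitaries: the identity plus a matrix of rank one\<close>

definition rank_one_update :: "nat \<Rightarrow> complex \<Rightarrow> (nat \<Rightarrow> complex) \<Rightarrow> complex mat" where
  "rank_one_update N c w = mat N N (\<lambda>(x, y). of_bool (x = y) + c * w x * cnj (w y))"

lemma rank_one_update_carrier: "rank_one_update N c w \<in> carrier_mat N N"
  by (simp add: rank_one_update_def)

lemma rank_one_update_mult_index:
  assumes "U \<in> carrier_mat N N" "x < N" "m < N"
  shows "(rank_one_update N c w * U) $$ (x, m) = U $$ (x, m) + c * w x * (\<Sum>y<N. cnj (w y) * U $$ (y, m))"
  using assms
  by (simp add: rank_one_update_def scalar_prod_def atLeast0LessThan distrib_right sum.distrib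
      sum_distrib_left mult.assoc)

text \<open>Updates along the same \<open>w\<close> compose by the rule that \<open>a\<close> and
  \<open>b\<close> give \<open>a + b + a * b * s\<close>, and the adjoint conjugates
  \<open>c\<close>. The condition on \<open>c\<close> thus says that the update and its adjoint are
  inverse; for \<open>s\<close> nonzero it means that the eigenvalue 1 + c s on \<open>w\<close> has
  modulus 1.\<close>

lemma rank_one_update_unitary:
  assumes s: "(\<Sum>y<N. cnj (w y) * w y) = s" and c: "c + cnj c + c * cnj c * s = 0"
  shows "rank_one_update N c w \<in> unitary_group N"
proof -
  have adj: "mat_adjoint (rank_one_update N c w) = rank_one_update N (cnj c) w"
  proof (rule eq_matI)
    fix i j assume "i < dim_row (rank_one_update N (cnj c) w)" "j < dim_col (rank_one_update N (cnj c) w)"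
    then have "i < N" "j < N" by (simp_all add: rank_one_update_def)
    then show "mat_adjoint (rank_one_update N c w) $$ (i, j) = rank_one_update N (cnj c) w $$ (i, j)"
      by (subst mat_adjoint_index[OF rank_one_update_carrier]) (auto simp: rank_one_update_def)
  qed (use mat_adjoint_carrier[OF rank_one_update_carrier, of N c w] in \<open>simp_all add: rank_one_update_def\<close>)
  have mult: "rank_one_update N a w * rank_one_update N b w = 1\<^sub>m N" if "a + b + a * b * s = 0" for a b
  proof (rule eq_matI)
    fix i j assume "i < dim_row (1\<^sub>m N :: complex mat)" "j < dim_col (1\<^sub>m N :: complex mat)"
    then have ij: "i < N" "j < N" by simp_all
    have "(\<Sum>y<N. cnj (w y) * rank_one_update N b w $$ (y, j))
        = (\<Sum>y<N. cnj (w y) * of_bool (y = j) + (cnj (w y) * w y) * (b * cnj (w j)))"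
      using ij by (intro sum.cong refl) (simp add: rank_one_update_def distrib_left mult_ac)
    also have "\<dots> = (\<Sum>y<N. cnj (w y) * of_bool (y = j)) + (\<Sum>y<N. (cnj (w y) * w y) * (b * cnj (w j)))"
      by (rule sum.distrib)
    also have "\<dots> = cnj (w j) + s * b * cnj (w j)"
      using ij by (simp add: sum_distrib_right[symmetric] s)
    finally have "(rank_one_update N a w * rank_one_update N b w) $$ (i, j)
        = of_bool (i = j) + (a + b + a * b * s) * (w i * cnj (w j))"
      using ij by (simp add: rank_one_update_mult_index[OF rank_one_update_carrier])
        (simp add: rank_one_update_def algebra_simps)
    then show "(rank_one_update N a w * rank_one_update N b w) $$ (i, j) = 1\<^sub>m N $$ (i, j)"
      using ij that by simp
  qed (simp_all add: rank_one_update_def)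
  show ?thesis
    using mult[of "cnj c" c] mult[of c "cnj c"] c rank_one_update_carrier
    by (simp add: unitary_group_def adj add.commute mult.commute)
qed

lemma obtain_phase_unitary:
  assumes "x < N"
  obtains V where "V \<in> unitary_group N"
    "\<And>U z m. U \<in> carrier_mat N N \<Longrightarrow> z < N \<Longrightarrow> m < N \<Longrightarrow>
      (V * U) $$ (z, m) = (if z = x then \<i> else 1) * U $$ (z, m)"
proof -
  \<comment> \<open>Along a unit vector the eigenvalue is 1 + c, so c = i - 1 gives the phase
    i.\<close>
  let ?V = "rank_one_update N (\<i> - 1) (\<lambda>z. if z = x then 1 else 0)"
  show ?thesis
  proof
    show "?V \<in> unitary_group N"
      using assms by (intro rank_one_update_unitary[where s = 1]) (auto simp: algebra_simps if_distrib cong: if_cong)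
    show "(?V * U) $$ (z, m) = (if z = x then \<i> else 1) * U $$ (z, m)"
      if "U \<in> carrier_mat N N" "z < N" "m < N" for U z m
    proof -
      have "(\<Sum>y<N. cnj (if y = x then 1 else 0) * U $$ (y, m)) = (\<Sum>y<N. if y = x then U $$ (y, m) else 0)"
        by (intro sum.cong) auto
      then show ?thesis using assms that by (simp add: rank_one_update_mult_index algebra_simps)
    qed
  qed
qed

lemma sum_two_points:
  fixes f :: "nat \<Rightarrow> complex"
  assumes "x < N" "y < N" "x \<noteq> y"
  shows "(\<Sum>z<N. (if z = x then a else if z = y then b else 0) * f z) = a * f x + b * f y"
proof -
  have "(if z = x then a else if z = y then b else 0) * f z
      = (if z = x then a * f x else 0) + (if z = y then b * f y else 0)" for z
    using assms(3) by auto
  then show ?thesis using assms by (simp add: sum.distrib)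
qed

text \<open>The reflection that negates a e_x + b e_y: the condition on \<open>c\<close> says c = -2
  / (a^2 + b^2).\<close>

lemma two_point_reflection:
  fixes a b c :: real and w :: "nat \<Rightarrow> complex"
  assumes xy: "x < N" "y < N" "x \<noteq> y" and c: "2 + c * (a\<^sup>2 + b\<^sup>2) = 0"
  defines "w \<equiv> (\<lambda>z. if z = x then complex_of_real a else if z = y then complex_of_real b else 0)"
  shows "rank_one_update N c w \<in> unitary_group N"
    and "U \<in> carrier_mat N N \<Longrightarrow> z < N \<Longrightarrow> m < N \<Longrightarrow>
      (rank_one_update N c w * U) $$ (z, m) = U $$ (z, m) + c * w z * (a * U $$ (x, m) + b * U $$ (y, m))"
proof -
  have cw: "cnj (w z) = w z" for z by (simp add: w_def)
  have "(\<Sum>z<N. cnj (w z) * w z) = complex_of_real (a\<^sup>2 + b\<^sup>2)"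
    unfolding cw using sum_two_points[OF xy, of a b w] xy(3)
    by (simp add: w_def power2_eq_square)
  moreover have "complex_of_real c + cnj c + c * cnj c * complex_of_real (a\<^sup>2 + b\<^sup>2)
      = complex_of_real (c * (2 + c * (a\<^sup>2 + b\<^sup>2)))"
    by (simp add: algebra_simps)
  ultimately show "rank_one_update N c w \<in> unitary_group N"
    using c by (intro rank_one_update_unitary) auto
  show "(rank_one_update N c w * U) $$ (z, m) = U $$ (z, m) + c * w z * (a * U $$ (x, m) + b * U $$ (y, m))"
    if "U \<in> carrier_mat N N" "z < N" "m < N"
    using sum_two_points[OF xy, of a b "\<lambda>z. U $$ (z, m)"] that
    by (simp only: rank_one_update_mult_index cw) (simp add: w_def)
qed

lemma obtain_swap_unitary:
  assumes "x < N" "y < N"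
  obtains V where "V \<in> unitary_group N"
    "\<And>U z m. U \<in> carrier_mat N N \<Longrightarrow> z < N \<Longrightarrow> m < N \<Longrightarrow>
      (V * U) $$ (z, m) = U $$ (Transposition.transpose x y z, m)"
proof (cases "x = y")
  case True
  show ?thesis
  proof (rule that)
    show "rank_one_update N 0 (\<lambda>_. 0) \<in> unitary_group N"
      by (rule rank_one_update_unitary) auto
  qed (simp add: rank_one_update_mult_index True)
next
  case False
  show ?thesis
    \<comment> \<open>The reflection along e_x - e_y exchanges the two coordinates.\<close>
    using two_point_reflection[OF assms False, where a = 1 and b = "-1" and c = "-1"]
    by (intro that) (auto simp: Transposition.transpose_def)
qed

text \<open>The reflection along e_x + 2 e_y. Since 1 + 4 = 5, its row x is the rational unit vector
  (3/5, -4/5), with both entries nonzero as the comparison of moments requires.\<close>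

lemma obtain_rotation_unitary:
  assumes "x < N" "y < N" "x \<noteq> y"
  obtains V where "V \<in> unitary_group N"
    "\<And>U m. U \<in> carrier_mat N N \<Longrightarrow> m < N \<Longrightarrow>
      (V * U) $$ (x, m) = 3/5 * U $$ (x, m) - 4/5 * U $$ (y, m)"
proof -
  note r = two_point_reflection[OF assms, where a = 1 and b = 2 and c = "-2/5"]
  show ?thesis
  proof (rule that)
    show "rank_one_update N (complex_of_real (-2/5))
        (\<lambda>z. if z = x then complex_of_real 1 else if z = y then complex_of_real 2 else 0) \<in> unitary_group N"
      by (rule r(1)) simp
  next
    fix U :: "complex mat" and m assume "U \<in> carrier_mat N N" "m < N"
    then show "(rank_one_update N (complex_of_real (-2/5))
        (\<lambda>z. if z = x then complex_of_real 1 else if z = y then complex_of_real 2 else 0) * U) $$ (x, m)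
      = 3/5 * U $$ (x, m) - 4/5 * U $$ (y, m)"
      using assms(1) by (subst r(2)) (simp_all add: field_simps)
  qed
qed

section \<open>Haar measure: measurability and change of variables\<close>

locale haar =
  fixes N :: nat and H :: "complex mat measure"
  assumes haar: "haar_unitary N H"
begin

sublocale prob_space H using haar by (simp add: haar_unitary_def)

lemma sets_H: "sets H = sets (unitary_borel N)"
  using haar by (simp add: haar_unitary_def)

lemma space_H: "space H = unitary_group N"
  unfolding sets_eq_imp_space_eq[OF sets_H]
  by (auto simp: unitary_borel_def space_restrict_space unitary_group_def)

lemma measurable_entry [measurable]:
  assumes "p < N" "m < N"
  shows "(\<lambda>U. U $$ (p, m)) \<in> borel_measurable H"
proof -
  let ?I = "{..<N} \<times> {..<N}" and ?f = "\<lambda>A. \<lambda>p\<in>{..<N} \<times> {..<N}. A $$ p :: complex"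
  have "?f \<in> measurable (vimage_algebra (carrier_mat N N) ?f (Pi\<^sub>M ?I (\<lambda>_. borel))) (Pi\<^sub>M ?I (\<lambda>_. borel))"
    by (rule measurable_vimage_algebra1) (auto simp: space_PiM)
  then have "(\<lambda>A. ?f A (p, m)) \<in> borel_measurable (vimage_algebra (carrier_mat N N) ?f (Pi\<^sub>M ?I (\<lambda>_. borel)))"
    by (rule measurable_compose[OF _ measurable_component_singleton]) (use assms in auto)
  then have "(\<lambda>A. A $$ (p, m)) \<in> borel_measurable (vimage_algebra (carrier_mat N N) ?f (Pi\<^sub>M ?I (\<lambda>_. borel)))"
    using assms by simp
  then have "(\<lambda>A. A $$ (p, m)) \<in> borel_measurable (unitary_borel N)"
    unfolding unitary_borel_def by (rule measurable_restrict_space1)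
  then show ?thesis using measurable_cong_sets[OF sets_H refl] by blast
qed

text \<open>Invariance is stated through \<open>distr\<close>, which is a genuine change of
  variables only for a measurable map; measurability holds because the entries of
  \<open>V * U\<close> are linear in those of \<open>U\<close>.\<close>

lemma measurable_left_mult:
  assumes V: "V \<in> unitary_group N"
  shows "(\<lambda>U. V * U) \<in> measurable H H"
proof -
  let ?I = "{..<N} \<times> {..<N}" and ?f = "\<lambda>A. \<lambda>p\<in>{..<N} \<times> {..<N}. A $$ p :: complex"
  have cV: "V \<in> carrier_mat N N" using V by (rule unitary_group_carrier)
  have "(\<lambda>U. V * U) \<in> measurable H (unitary_borel N)"
    unfolding unitary_borel_def
  proof (rule measurable_restrict_space2)
    show "(\<lambda>U. V * U) \<in> space H \<rightarrow> unitary_group N"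
    proof
      fix U assume "U \<in> space H"
      then have U: "U \<in> unitary_group N" by (simp add: space_H)
      have cU: "U \<in> carrier_mat N N" using U by (rule unitary_group_carrier)
      have c: "mat_adjoint U \<in> carrier_mat N N" "mat_adjoint V \<in> carrier_mat N N"
        using cU cV by (auto intro: mat_adjoint_carrier)
      have adj: "mat_adjoint (V * U) = mat_adjoint U * mat_adjoint V"
      proof (rule eq_matI)
        fix i j assume "i < dim_row (mat_adjoint U * mat_adjoint V)" "j < dim_col (mat_adjoint U * mat_adjoint V)"
        then have ij: "i < N" "j < N" using c by auto
        show "mat_adjoint (V * U) $$ (i, j) = (mat_adjoint U * mat_adjoint V) $$ (i, j)"
          using ij cU cV c
          by (subst mat_adjoint_index[of _ N])
             (auto simp: scalar_prod_def mat_adjoint_index[of _ N] mult.commute intro!: sum.cong)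
      qed (use c mat_adjoint_carrier[OF mult_carrier_mat[OF cV cU]] in auto)
      have 1: "mat_adjoint (V * U) * (V * U) = mat_adjoint U * ((mat_adjoint V * V) * U)"
        unfolding adj using cU cV c
        by (smt (verit) assoc_mult_mat mult_carrier_mat)
      have 2: "(V * U) * mat_adjoint (V * U) = V * ((U * mat_adjoint U) * mat_adjoint V)"
        unfolding adj using cU cV c
        by (smt (verit) assoc_mult_mat mult_carrier_mat)
      show "V * U \<in> unitary_group N"
        using U V cU cV c 1 2 by (auto simp: unitary_group_def)
    qed
    show "(\<lambda>U. V * U) \<in> measurable H (vimage_algebra (carrier_mat N N) ?f (Pi\<^sub>M ?I (\<lambda>_. borel)))"
    proof (rule measurable_vimage_algebra2)
      show "(\<lambda>U. V * U) \<in> space H \<rightarrow> carrier_mat N N"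
        using cV by (auto simp: space_H dest: unitary_group_carrier)
      show "(\<lambda>U. ?f (V * U)) \<in> measurable H (Pi\<^sub>M ?I (\<lambda>_. borel))"
      proof (rule measurable_restrict)
        fix pm assume "pm \<in> ?I"
        then obtain p m where pm: "pm = (p, m)" "p < N" "m < N" by auto
        have "(\<lambda>U. \<Sum>k<N. V $$ (p, k) * U $$ (k, m)) \<in> borel_measurable H"
          using pm(3) by (intro borel_measurable_sum borel_measurable_times measurable_entry) auto
        moreover have "(V * U) $$ (p, m) = (\<Sum>k<N. V $$ (p, k) * U $$ (k, m))" if "U \<in> space H" for U
          using that pm cV unitary_group_carrier[of U N]
          by (simp add: space_H scalar_prod_def atLeast0LessThan)
        ultimately show "(\<lambda>U. (V * U) $$ pm) \<in> borel_measurable H"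
          unfolding pm(1) by (subst measurable_cong) auto
      qed
    qed
  qed
  then show ?thesis using measurable_cong_sets[OF refl sets_H] by blast
qed

lemma integral_left_mult:
  fixes f :: "complex mat \<Rightarrow> complex"
  assumes "V \<in> unitary_group N" "f \<in> borel_measurable H"
  shows "(LINT U|H. f (V * U)) = (LINT U|H. f U)"
proof -
  have "distr H H (\<lambda>U. V * U) = H" using haar assms(1) by (simp add: haar_unitary_def)
  then show ?thesis
    using integral_distr[OF measurable_left_mult[OF assms(1)] assms(2)] by simp
qed

lemma integrable_bounded:
  fixes f :: "complex mat \<Rightarrow> complex"
  assumes "f \<in> borel_measurable H" "\<And>U. U \<in> unitary_group N \<Longrightarrow> norm (f U) \<le> B"
  shows "integrable H f"
  using assms by (intro integrable_const_bound[where B = B] AE_I2) (auto simp: space_H)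

end

lemma borel_measurable_cnj:
  "f \<in> borel_measurable M \<Longrightarrow> (\<lambda>x. cnj (f x)) \<in> borel_measurable M"
  by (rule borel_measurable_continuous_on[OF continuous_on_cnj[OF continuous_on_id]])

lemma eq_mult_self_imp_0: "z = c * z \<Longrightarrow> c \<noteq> 1 \<Longrightarrow> z = (0::complex)"
  by (metis mult_cancel_right1)

lemma sum_product4:
  fixes f g h k :: "'a \<Rightarrow> 'b::comm_semiring_0"
  shows "(\<Sum>p\<in>A. f p) * (\<Sum>q\<in>B. g q) * (\<Sum>p'\<in>C. h p') * (\<Sum>q'\<in>D. k q')
    = (\<Sum>p\<in>A. \<Sum>q\<in>B. \<Sum>p'\<in>C. \<Sum>q'\<in>D. f p * g q * h p' * k q')"
  by (simp only: sum_distrib_left[symmetric] sum_distrib_right[symmetric])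

lemma integral_sum_sum:
  fixes f :: "'a \<Rightarrow> 'b \<Rightarrow> 'c \<Rightarrow> complex"
  assumes "\<And>p q. p \<in> A \<Longrightarrow> q \<in> B \<Longrightarrow> integrable M (f p q)"
  shows "(LINT x|M. (\<Sum>p\<in>A. \<Sum>q\<in>B. f p q x)) = (\<Sum>p\<in>A. \<Sum>q\<in>B. LINT x|M. f p q x)"
  using assms by (simp add: Bochner_Integration.integral_sum Bochner_Integration.integrable_sum)

text \<open>Row exchanges act transitively on ordered pairs of distinct rows: exchange
  \<open>p\<close> with 0, then the image \<open>r\<close> of \<open>q\<close> with 1, which leaves
  0 fixed.\<close>

lemma distinct_pair_swap:
  fixes F :: "nat \<Rightarrow> nat \<Rightarrow> complex"
  assumes sw: "\<And>x y p q. x < N \<Longrightarrow> y < N \<Longrightarrow> p < N \<Longrightarrow> q < N \<Longrightarrow>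
      F p q = F (Transposition.transpose x y p) (Transposition.transpose x y q)"
    and pq: "p < N" "q < N" "p \<noteq> q"
  shows "F p q = F 0 1"
proof -
  define r where "r = Transposition.transpose p 0 q"
  have r: "r < N" "r \<noteq> 0" using pq by (auto simp: r_def Transposition.transpose_def)
  have N: "0 < N" "1 < N" using pq by auto
  have "F p q = F 0 r" using sw[OF pq(1) N(1) pq(1,2)] by (simp add: r_def)
  also have "\<dots> = F 0 1" using sw[OF r(1) N(2) N(1) r(1)] r(2) by (simp add: Transposition.transpose_def)
  finally show ?thesis .
qed

section \<open>First and second moments of the entries\<close>

context haar
begin

definition moment1 :: "nat \<Rightarrow> nat \<Rightarrow> nat \<Rightarrow> nat \<Rightarrow> complex" where
  "moment1 m s p q = (LINT U|H. U $$ (p, m) * cnj (U $$ (q, s)))"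

text \<open>The columns come first because they stay fixed: left multiplication acts on rows only.
  As a matrix with row (p, q) and column (p', q') this is the average of a matrix unit conjugated by
  U tensor U.\<close>

definition moment2 :: "nat \<Rightarrow> nat \<Rightarrow> nat \<Rightarrow> nat \<Rightarrow> nat \<Rightarrow> nat \<Rightarrow> nat \<Rightarrow> nat \<Rightarrow> complex" where
  "moment2 m m' s s' p q p' q' =
     (LINT U|H. U $$ (p, m) * U $$ (q, m') * cnj (U $$ (p', s)) * cnj (U $$ (q', s')))"

lemma measurable_entries1:
  assumes "m < N" "s < N" "p < N" "q < N"
  shows "(\<lambda>U. U $$ (p, m) * cnj (U $$ (q, s))) \<in> borel_measurable H"
  using assms by (intro borel_measurable_times borel_measurable_cnj measurable_entry)

lemma measurable_entries2:
  assumes "m < N" "m' < N" "s < N" "s' < N" "p < N" "q < N" "p' < N" "q' < N"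
  shows "(\<lambda>U. U $$ (p, m) * U $$ (q, m') * cnj (U $$ (p', s)) * cnj (U $$ (q', s'))) \<in> borel_measurable H"
  using assms by (intro borel_measurable_times borel_measurable_cnj measurable_entry)

lemma integrable_entries1:
  assumes "m < N" "s < N" "p < N" "q < N"
  shows "integrable H (\<lambda>U. U $$ (p, m) * cnj (U $$ (q, s)))"
  using assms unitary_entry_le_1
  by (intro integrable_bounded[where B = 1] measurable_entries1) (auto simp: norm_mult intro!: mult_le_one)

lemma integrable_entries2:
  assumes "m < N" "m' < N" "s < N" "s' < N" "p < N" "q < N" "p' < N" "q' < N"
  shows "integrable H (\<lambda>U. U $$ (p, m) * U $$ (q, m') * cnj (U $$ (p', s)) * cnj (U $$ (q', s')))"
  using assms unitary_entry_le_1
  by (intro integrable_bounded[where B = 1] measurable_entries2) (auto simp: norm_mult intro!: mult_le_one)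

context
  fixes m s :: nat
  assumes ms: "m < N" "s < N"
begin

lemma moment1_phase:
  assumes "x < N" "p < N" "q < N"
  defines "\<phi> \<equiv> (\<lambda>z. if z = x then \<i> else 1)"
  shows "moment1 m s p q = \<phi> p * cnj (\<phi> q) * moment1 m s p q"
proof -
  obtain V where V: "V \<in> unitary_group N" "\<And>U z m. U \<in> carrier_mat N N \<Longrightarrow> z < N \<Longrightarrow> m < N \<Longrightarrow>
      (V * U) $$ (z, m) = \<phi> z * U $$ (z, m)"
    using obtain_phase_unitary[OF assms(1)] unfolding \<phi>_def by metis
  have "moment1 m s p q = (LINT U|H. (V * U) $$ (p, m) * cnj ((V * U) $$ (q, s)))"
    unfolding moment1_def
    using integral_left_mult[OF V(1) measurable_entries1[OF ms assms(2,3)]] by simp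
  also have "\<dots> = (LINT U|H. (\<phi> p * cnj (\<phi> q)) * (U $$ (p, m) * cnj (U $$ (q, s))))"
    using V(2) unitary_group_carrier ms assms(2,3)
    by (intro Bochner_Integration.integral_cong) (auto simp: space_H mult_ac)
  finally show ?thesis by (simp add: moment1_def)
qed

lemma moment1_swap:
  assumes "x < N" "y < N" "p < N" "q < N"
  defines "\<pi> \<equiv> Transposition.transpose x y"
  shows "moment1 m s p q = moment1 m s (\<pi> p) (\<pi> q)"
proof -
  obtain V where V: "V \<in> unitary_group N" "\<And>U z m. U \<in> carrier_mat N N \<Longrightarrow> z < N \<Longrightarrow> m < N \<Longrightarrow>
      (V * U) $$ (z, m) = U $$ (\<pi> z, m)"
    using obtain_swap_unitary[OF assms(1,2)] unfolding \<pi>_def by metis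
  have "moment1 m s p q = (LINT U|H. (V * U) $$ (p, m) * cnj ((V * U) $$ (q, s)))"
    unfolding moment1_def
    using integral_left_mult[OF V(1) measurable_entries1[OF ms assms(3,4)]] by simp
  also have "\<dots> = moment1 m s (\<pi> p) (\<pi> q)"
    unfolding moment1_def using V(2) unitary_group_carrier ms assms(3,4)
    by (intro Bochner_Integration.integral_cong) (auto simp: space_H)
  finally show ?thesis .
qed

text \<open>A phase i in row \<open>p\<close> kills the moments with distinct rows, exchanges make
  those with equal rows agree, and the sum of the latter is the inner product of the columns
  \<open>m\<close> and \<open>s\<close>.\<close>

lemma moment1_eq:
  assumes "p < N" "q < N"
  shows "moment1 m s p q = of_bool (p = q \<and> m = s) / N"
proof (cases "p = q")
  case False
  then have "moment1 m s p q = 0"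
    by (intro eq_mult_self_imp_0[OF moment1_phase[OF assms(1) assms]]) (simp add: complex_eq_iff)
  then show ?thesis using False by simp
next
  case True
  have "(\<Sum>x<N. moment1 m s x x) = (LINT U|H. (\<Sum>x<N. U $$ (x, m) * cnj (U $$ (x, s))))"
    unfolding moment1_def using ms by (intro Bochner_Integration.integral_sum[symmetric] integrable_entries1) auto
  also have "\<dots> = (LINT U|H. of_bool (m = s))"
    using ms by (intro Bochner_Integration.integral_cong refl unitary_columns) (simp_all add: space_H)
  finally have "(\<Sum>x<N. moment1 m s x x) = of_bool (m = s)" by (simp add: prob_space)
  moreover have "moment1 m s x x = moment1 m s p p" if "x < N" for x
    using moment1_swap[OF that assms(1) that that] by simp
  ultimately have "of_nat N * moment1 m s p p = of_bool (m = s)" by simp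
  then show ?thesis using True assms by (auto simp: field_simps)
qed

end

context
  fixes m m' s s' :: nat
  assumes ms: "m < N" "m' < N" "s < N" "s' < N"
begin

abbreviation "M2 \<equiv> moment2 m m' s s'"

lemma moment2_invariant:
  assumes "V \<in> unitary_group N" "p < N" "q < N" "p' < N" "q' < N"
  shows "M2 p q p' q' = (LINT U|H. (V * U) $$ (p, m) * (V * U) $$ (q, m') *
    cnj ((V * U) $$ (p', s)) * cnj ((V * U) $$ (q', s')))"
  unfolding moment2_def
  using integral_left_mult[OF assms(1) measurable_entries2[OF ms assms(2-5)]] by simp

lemma moment2_phase:
  assumes "x < N" "p < N" "q < N" "p' < N" "q' < N"
  defines "\<phi> \<equiv> (\<lambda>z. if z = x then \<i> else 1)"
  shows "M2 p q p' q' = \<phi> p * \<phi> q * cnj (\<phi> p') * cnj (\<phi> q') * M2 p q p' q'"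
proof -
  obtain V where V: "V \<in> unitary_group N" "\<And>U z m. U \<in> carrier_mat N N \<Longrightarrow> z < N \<Longrightarrow> m < N \<Longrightarrow>
      (V * U) $$ (z, m) = \<phi> z * U $$ (z, m)"
    using obtain_phase_unitary[OF assms(1)] unfolding \<phi>_def by metis
  have "M2 p q p' q' = (LINT U|H. (\<phi> p * \<phi> q * cnj (\<phi> p') * cnj (\<phi> q')) *
      (U $$ (p, m) * U $$ (q, m') * cnj (U $$ (p', s)) * cnj (U $$ (q', s'))))"
    unfolding moment2_invariant[OF V(1) assms(2-5)]
    using V(2) unitary_group_carrier ms assms(2-5)
    by (intro Bochner_Integration.integral_cong) (auto simp: space_H mult_ac)
  then show ?thesis by (simp add: moment2_def)
qed

text \<open>The phase i is put on row \<open>q\<close> if \<open>p\<close> occurs among the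
  conjugated rows, and on row \<open>p\<close> otherwise. The resulting factor is i or -1. The value
  -1 is i^2 and arises for p = q absent from {p', q'}; a mere change of sign of that row would give
  1 there.\<close>

lemma moment2_eq_0:
  assumes "p < N" "q < N" "p' < N" "q' < N"
    and "\<not> (p = p' \<and> q = q')" "\<not> (p = q' \<and> q = p')"
  shows "M2 p q p' q' = 0"
proof (cases "p = p' \<or> p = q'")
  case True
  then show ?thesis
    using assms(5,6) by (intro eq_mult_self_imp_0[OF moment2_phase[OF assms(2) assms(1-4)]])
      (auto simp: complex_eq_iff split: if_splits)
next
  case False
  then show ?thesis
    by (intro eq_mult_self_imp_0[OF moment2_phase[OF assms(1) assms(1-4)]])
      (auto simp: complex_eq_iff split: if_splits)
qed

lemma moment2_swap:
  assumes "x < N" "y < N" "p < N" "q < N" "p' < N" "q' < N"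
  defines "\<pi> \<equiv> Transposition.transpose x y"
  shows "M2 p q p' q' = M2 (\<pi> p) (\<pi> q) (\<pi> p') (\<pi> q')"
proof -
  obtain V where V: "V \<in> unitary_group N" "\<And>U z m. U \<in> carrier_mat N N \<Longrightarrow> z < N \<Longrightarrow> m < N \<Longrightarrow>
      (V * U) $$ (z, m) = U $$ (\<pi> z, m)"
    using obtain_swap_unitary[OF assms(1,2)] unfolding \<pi>_def by metis
  show ?thesis
    unfolding moment2_invariant[OF V(1) assms(3-6)] unfolding moment2_def
    using V(2) unitary_group_carrier ms assms(3-6)
    by (intro Bochner_Integration.integral_cong) (auto simp: space_H)
qed

text \<open>Phases and row exchanges leave the moments of a single row free; a reflection whose first row is
  \<open>(3/5, -4/5)\<close> ties them to the mixed ones.\<close>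

lemma moment2_row:
  assumes xy: "x < N" "y < N" "x \<noteq> y"
  shows "2 * M2 x x x x = M2 x y x y + M2 x y y x + M2 y x x y + M2 y x y x"
proof -
  obtain V where V: "V \<in> unitary_group N" "\<And>U m. U \<in> carrier_mat N N \<Longrightarrow> m < N \<Longrightarrow>
      (V * U) $$ (x, m) = 3/5 * U $$ (x, m) - 4/5 * U $$ (y, m)"
    using obtain_rotation_unitary[OF xy] by metis
  define a where "a = (\<lambda>z. if z = x then 3/5 else -4/5 :: complex)"
  have row: "(V * U) $$ (x, k) = (\<Sum>z\<in>{x, y}. a z * U $$ (z, k))" if "U \<in> space H" "k < N" for U k
    using V(2)[of U k] that xy by (simp add: a_def space_H unitary_group_carrier)
  have ca: "cnj (a z) = a z" for z by (simp add: a_def)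
  have "M2 x x x x = (LINT U|H. (\<Sum>p\<in>{x, y}. \<Sum>q\<in>{x, y}. \<Sum>p'\<in>{x, y}. \<Sum>q'\<in>{x, y}. (a p * a q * a p' * a q') *
      (U $$ (p, m) * U $$ (q, m') * cnj (U $$ (p', s)) * cnj (U $$ (q', s')))))"
    unfolding moment2_invariant[OF V(1) xy(1) xy(1) xy(1) xy(1)]
  proof (intro Bochner_Integration.integral_cong refl)
    fix U assume "U \<in> space H"
    then show "(V * U) $$ (x, m) * (V * U) $$ (x, m') * cnj ((V * U) $$ (x, s)) * cnj ((V * U) $$ (x, s'))
      = (\<Sum>p\<in>{x, y}. \<Sum>q\<in>{x, y}. \<Sum>p'\<in>{x, y}. \<Sum>q'\<in>{x, y}. (a p * a q * a p' * a q') *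
      (U $$ (p, m) * U $$ (q, m') * cnj (U $$ (p', s)) * cnj (U $$ (q', s'))))"
      using ms by (simp only: row cnj_sum complex_cnj_mult ca sum_product4)
        (intro sum.cong refl, simp only: mult_ac)
  qed
  also have "\<dots> = (\<Sum>p\<in>{x, y}. \<Sum>q\<in>{x, y}. \<Sum>p'\<in>{x, y}. \<Sum>q'\<in>{x, y}. (a p * a q * a p' * a q') * M2 p q p' q')"
  proof -
    have lt: "z < N" if "z \<in> {x, y}" for z using that xy by auto
    then have int: "integrable H (\<lambda>U. (a p * a q * a p' * a q') *
        (U $$ (p, m) * U $$ (q, m') * cnj (U $$ (p', s)) * cnj (U $$ (q', s'))))"
      if "p \<in> {x, y}" "q \<in> {x, y}" "p' \<in> {x, y}" "q' \<in> {x, y}" for p q p' q'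
      using ms that by (intro integrable_mult_right integrable_entries2)
    show ?thesis
      unfolding moment2_def integral_mult_right_zero[symmetric]
      by (subst integral_sum_sum, intro Bochner_Integration.integrable_sum int, assumption+,
          intro sum.cong refl integral_sum_sum int, assumption+)
  qed
  \<comment> \<open>Of the 16 terms only six are paired and survive, with weights 3^4 = 81, 4^4 =
    256 and 3^2 4^2 = 144 over 5^4 = 625. As 625 - 81 - 256 is twice 144, the relation for the
    equal-row moment drops out.\<close>
  also have "\<dots> = (81 * M2 x x x x + 256 * M2 y y y y
      + 144 * (M2 x y x y + M2 x y y x + M2 y x x y + M2 y x y x)) / 625"
    using xy moment2_eq_0 by (simp add: a_def field_simps)
  also have "M2 y y y y = M2 x x x x"
    using moment2_swap[OF xy(1,2) xy(1) xy(1) xy(1) xy(1)] by simp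
  finally have "144 * (2 * M2 x x x x) = 144 * (M2 x y x y + M2 x y y x + M2 y x x y + M2 y x y x)"
    by (simp add: field_simps)
  then show ?thesis by (simp only: mult_cancel_left) simp
qed

text \<open>Entrywise form of the fact that a matrix commuting with every V tensor V is a
  combination of the identity and the swap. Both coefficients are read off at the rows 0 and 1;
  \<open>moment2_row\<close> forces the moment with four equal rows to be their sum.\<close>

lemma moment2_commutant:
  assumes N: "2 \<le> N" and pq: "p < N" "q < N" "p' < N" "q' < N"
  shows "M2 p q p' q' = M2 0 1 0 1 * of_bool (p = p' \<and> q = q') + M2 0 1 1 0 * of_bool (p = q' \<and> q = p')"
proof -
  have a: "M2 x y x y = M2 0 1 0 1" if "x < N" "y < N" "x \<noteq> y" for x y
    using that by (intro distinct_pair_swap[where F = "\<lambda>x y. M2 x y x y"] moment2_swap)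
  have b: "M2 x y y x = M2 0 1 1 0" if "x < N" "y < N" "x \<noteq> y" for x y
    using that by (intro distinct_pair_swap[where F = "\<lambda>x y. M2 x y y x"] moment2_swap)
  have c: "M2 x x x x = M2 0 1 0 1 + M2 0 1 1 0" if "x < N" for x
  proof -
    obtain y where "y < N" "x \<noteq> y" using N
      by (metis less_le_trans one_less_numeral_iff semiring_norm(76) zero_less_numeral zero_neq_one)
    then have "2 * M2 x x x x = 2 * (M2 0 1 0 1 + M2 0 1 1 0)"
      using moment2_row[of x y] a[of x y] a[of y x] b[of x y] b[of y x] that by simp
    then show ?thesis by (simp only: mult_cancel_left) simp
  qed
  show ?thesis
  proof (cases "p = q")
    case True
    then show ?thesis using c[of p] moment2_eq_0[OF pq] pq by auto
  next
    case False
    then show ?thesis using a[of p q] b[of p q] moment2_eq_0[OF pq] pq by auto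
  qed
qed

text \<open>Contracting the rows by either pairing leaves inner products of columns. These two
  values are the data that fix the two coefficients of the commutant.\<close>

lemma moment2_contract:
  "(\<Sum>p<N. \<Sum>q<N. M2 p q p q) = of_bool (m = s \<and> m' = s')"
  "(\<Sum>p<N. \<Sum>q<N. M2 p q q p) = of_bool (m = s' \<and> m' = s)"
proof -
  have "(\<Sum>p<N. \<Sum>q<N. M2 p q p q) = (LINT U|H. (\<Sum>p<N. \<Sum>q<N.
      U $$ (p, m) * U $$ (q, m') * cnj (U $$ (p, s)) * cnj (U $$ (q, s'))))"
    unfolding moment2_def using ms
    by (intro integral_sum_sum[symmetric] integrable_entries2) auto
  also have "\<dots> = (LINT U|H. of_bool (m = s \<and> m' = s'))"
  proof (intro Bochner_Integration.integral_cong refl)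
    fix U assume "U \<in> space H"
    then have U: "U \<in> unitary_group N" by (simp add: space_H)
    have "(\<Sum>p<N. \<Sum>q<N. U $$ (p, m) * U $$ (q, m') * cnj (U $$ (p, s)) * cnj (U $$ (q, s')))
      = (\<Sum>p<N. U $$ (p, m) * cnj (U $$ (p, s))) * (\<Sum>q<N. U $$ (q, m') * cnj (U $$ (q, s')))"
      unfolding sum_product by (intro sum.cong refl) (simp add: mult_ac)
    then show "(\<Sum>p<N. \<Sum>q<N. U $$ (p, m) * U $$ (q, m') * cnj (U $$ (p, s)) * cnj (U $$ (q, s')))
      = of_bool (m = s \<and> m' = s')"
      using unitary_columns[OF U] ms by simp
  qed
  finally show "(\<Sum>p<N. \<Sum>q<N. M2 p q p q) = of_bool (m = s \<and> m' = s')" by (simp add: prob_space)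
  have "(\<Sum>p<N. \<Sum>q<N. M2 p q q p) = (LINT U|H. (\<Sum>p<N. \<Sum>q<N.
      U $$ (p, m) * U $$ (q, m') * cnj (U $$ (q, s)) * cnj (U $$ (p, s'))))"
    unfolding moment2_def using ms
    by (intro integral_sum_sum[symmetric] integrable_entries2) auto
  also have "\<dots> = (LINT U|H. of_bool (m = s' \<and> m' = s))"
  proof (intro Bochner_Integration.integral_cong refl)
    fix U assume "U \<in> space H"
    then have U: "U \<in> unitary_group N" by (simp add: space_H)
    have "(\<Sum>p<N. \<Sum>q<N. U $$ (p, m) * U $$ (q, m') * cnj (U $$ (q, s)) * cnj (U $$ (p, s')))
      = (\<Sum>p<N. U $$ (p, m) * cnj (U $$ (p, s'))) * (\<Sum>q<N. U $$ (q, m') * cnj (U $$ (q, s)))"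
      unfolding sum_product by (intro sum.cong refl) (simp add: mult_ac)
    then show "(\<Sum>p<N. \<Sum>q<N. U $$ (p, m) * U $$ (q, m') * cnj (U $$ (q, s)) * cnj (U $$ (p, s')))
      = of_bool (m = s' \<and> m' = s)"
      using unitary_columns[OF U] ms by simp
  qed
  finally show "(\<Sum>p<N. \<Sum>q<N. M2 p q q p) = of_bool (m = s' \<and> m' = s)" by (simp add: prob_space)
qed

text \<open>The coefficients \<open>A\<close> and \<open>B\<close> solve the linear system whose
  left sides are N^2 A + N B and N A + N^2 B and whose right sides are the two contractions;
  \<open>a\<close> and \<open>b\<close> are the entries of the inverse matrix.\<close>

lemma moment2_eq:
  assumes N: "2 \<le> N" and pq: "p < N" "q < N" "p' < N" "q' < N"
  defines "a \<equiv> 1 / (of_nat N ^ 2 - 1)" and "b \<equiv> - 1 / (of_nat N * (of_nat N ^ 2 - 1))"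
  shows "M2 p q p' q' =
      of_bool (p = p' \<and> q = q') * (a * of_bool (m = s \<and> m' = s') + b * of_bool (m = s' \<and> m' = s))
    + of_bool (p = q' \<and> q = p') * (b * of_bool (m = s \<and> m' = s') + a * of_bool (m = s' \<and> m' = s))"
proof -
  define A B where "A = M2 0 1 0 1" and "B = M2 0 1 1 0"
  let ?n = "of_nat N :: complex"
  have "(\<Sum>p<N. \<Sum>q<N. M2 p q p q) = (\<Sum>p<N. \<Sum>q<N. A + (if q = p then B else 0))"
    by (intro sum.cong refl) (subst moment2_commutant[OF N], auto simp: A_def B_def)
  then have 1: "?n * (?n * A) + ?n * B = of_bool (m = s \<and> m' = s')"
    unfolding moment2_contract by (simp add: sum.distrib distrib_left)
  have "(\<Sum>p<N. \<Sum>q<N. M2 p q q p) = (\<Sum>p<N. \<Sum>q<N. B + (if q = p then A else 0))"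
    by (intro sum.cong refl) (subst moment2_commutant[OF N], auto simp: A_def B_def)
  then have 2: "?n * (?n * B) + ?n * A = of_bool (m = s' \<and> m' = s)"
    unfolding moment2_contract by (simp add: sum.distrib distrib_left)
  have n0: "?n \<noteq> 0" using N by simp
  have "(1::real) < real N ^ 2" using N by (simp add: one_less_power)
  then have "real N ^ 2 - 1 \<noteq> 0" by simp
  then have n1: "?n ^ 2 - 1 \<noteq> 0" 
    by (metis of_real_1 of_real_diff of_real_eq_0_iff of_real_of_nat_eq of_real_power)
  have bn: "b * ?n = - a" and an: "a * (?n ^ 2 - 1) = 1"
    unfolding a_def b_def using n0 n1 by (simp_all add: divide_simps)
  have inv: "a * (?n * (?n * x) + ?n * y) + b * (?n * (?n * y) + ?n * x) = x" for x y
  proof -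
    have "a * (?n * (?n * x) + ?n * y) + b * (?n * (?n * y) + ?n * x)
        = a * (?n * (?n * x) + ?n * y) + (b * ?n) * (?n * y + x)"
      by (simp add: algebra_simps)
    also have "\<dots> = (a * (?n ^ 2 - 1)) * x"
      unfolding bn by (simp add: algebra_simps power2_eq_square)
    finally show ?thesis unfolding an by simp
  qed
  have "A = a * (?n * (?n * A) + ?n * B) + b * (?n * (?n * B) + ?n * A)"
    by (rule inv[symmetric])
  moreover have "B = b * (?n * (?n * A) + ?n * B) + a * (?n * (?n * B) + ?n * A)"
    using inv[of B A] by (simp add: add.commute)
  ultimately show ?thesis
    unfolding moment2_commutant[OF N pq] A_def[symmetric] B_def[symmetric] 1 2 by (simp add: mult.commute)
qed

end

end

section \<open>Expected norm and purity\<close>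

text \<open>For one fixed path the summand is a product of functions of different sites, so
  independence gives a product of expectations; the sum over the paths is handled by
  linearity.\<close>

lemma (in prob_space) cyclic_sum_integral:
  fixes G :: "nat \<Rightarrow> 'a \<Rightarrow> 'i \<Rightarrow> 'i \<Rightarrow> complex"
  assumes n: "0 < n"
    and G: "\<And>j p q. j < n \<Longrightarrow> p \<in> E \<Longrightarrow> q \<in> E \<Longrightarrow> integrable M (\<lambda>V. G j V p q)"
  shows "integrable (Pi\<^sub>M {..<n} (\<lambda>_. M)) (\<lambda>U. cyclic_sum n E (\<lambda>j. G j (U j)))"
    and "(LINT U|Pi\<^sub>M {..<n} (\<lambda>_. M). cyclic_sum n E (\<lambda>j. G j (U j)))
      = cyclic_sum n E (\<lambda>j p q. LINT V|M. G j V p q)"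
proof -
  interpret product_prob_space "\<lambda>_. M" "{..<n}" by unfold_locales
  have int: "integrable M (\<lambda>V. G j V (k j) (k (Suc j mod n)))" if "k \<in> {..<n} \<rightarrow>\<^sub>E E" "j \<in> {..<n}" for k j
  proof -
    have "Suc j mod n < n" using n by simp
    then show ?thesis using that by (intro G) (auto simp: PiE_iff)
  qed
  have i: "integrable (Pi\<^sub>M {..<n} (\<lambda>_. M)) (\<lambda>U. \<Prod>j<n. G j (U j) (k j) (k (Suc j mod n)))"
    if "k \<in> {..<n} \<rightarrow>\<^sub>E E" for k
    by (rule product_integrable_prod[OF finite_lessThan int[OF that]])
  then show "integrable (Pi\<^sub>M {..<n} (\<lambda>_. M)) (\<lambda>U. cyclic_sum n E (\<lambda>j. G j (U j)))"
    unfolding cyclic_sum_def by (rule Bochner_Integration.integrable_sum)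
  have "(LINT U|Pi\<^sub>M {..<n} (\<lambda>_. M). cyclic_sum n E (\<lambda>j. G j (U j)))
      = (\<Sum>k\<in>{..<n} \<rightarrow>\<^sub>E E. LINT U|Pi\<^sub>M {..<n} (\<lambda>_. M). (\<Prod>j<n. G j (U j) (k j) (k (Suc j mod n))))"
    unfolding cyclic_sum_def by (rule Bochner_Integration.integral_sum[OF i])
  also have "\<dots> = cyclic_sum n E (\<lambda>j p q. LINT V|M. G j V p q)"
    unfolding cyclic_sum_def
  proof (rule sum.cong[OF refl])
    fix k assume k: "k \<in> {..<n} \<rightarrow>\<^sub>E E"
    show "(LINT U|Pi\<^sub>M {..<n} (\<lambda>_. M). (\<Prod>j<n. G j (U j) (k j) (k (Suc j mod n))))
      = (\<Prod>j<n. LINT V|M. G j V (k j) (k (Suc j mod n)))"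
      by (rule product_integral_prod[OF finite_lessThan int[OF k]])
  qed
  finally show "(LINT U|Pi\<^sub>M {..<n} (\<lambda>_. M). cyclic_sum n E (\<lambda>j. G j (U j)))
      = cyclic_sum n E (\<lambda>j p q. LINT V|M. G j V p q)" .
qed

section \<open>Norm and purity as closed sums\<close>

lemma mps_state_eq:
  assumes "0 < n" "x \<in> configs d {..<n}"
  shows "mps_state d n D U x = cyclic_sum n {..<D} (\<lambda>j p q. U j $$ (x j * D + p, q))"
proof -
  have "mps_state d n D U x = mat_trace (foldr (*) (map (\<lambda>j. mps_block D (U j) (x j)) [0..<n]) (1\<^sub>m D))"
    using assms(2) by (simp add: mps_state_def)
  also have "\<dots> = cyclic_sum n {..<D} (\<lambda>j p q. mps_block D (U j) (x j) $$ (p, q))"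
    using assms(1) by (intro mat_trace_foldr) (auto simp: mps_block_def)
  also have "\<dots> = cyclic_sum n {..<D} (\<lambda>j p q. U j $$ (x j * D + p, q))"
    by (intro cyclic_sum_cong) (simp add: mps_block_def)
  finally show ?thesis .
qed

definition glue :: "nat \<Rightarrow> nat set \<Rightarrow> (nat \<Rightarrow> nat) \<Rightarrow> (nat \<Rightarrow> nat) \<Rightarrow> nat \<Rightarrow> nat" where
  "glue n A u v = (\<lambda>j\<in>{..<n}. if j \<in> A then u j else v j)"

lemma glue_configs: "u \<in> configs d {..<n} \<Longrightarrow> v \<in> configs d {..<n} \<Longrightarrow> glue n A u v \<in> configs d {..<n}"
  unfolding glue_def configs_def restrict_PiE_iff by (auto dest: PiE_mem)

text \<open>The swap trick: the two kets carry the labels \<open>u\<close> and \<open>v\<close>, the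
  two bras carry them with the parts on \<open>A\<close> exchanged. This writes the trace of the
  squared reduced operator as a polynomial in the amplitudes, which can be averaged
  directly.\<close>

definition purity_sum :: "nat \<Rightarrow> nat \<Rightarrow> nat set \<Rightarrow> ((nat \<Rightarrow> nat) \<Rightarrow> complex) \<Rightarrow> complex" where
  "purity_sum d n A \<psi> = (\<Sum>u\<in>configs d {..<n}. \<Sum>v\<in>configs d {..<n}.
     \<psi> u * \<psi> v * cnj (\<psi> (glue n A v u)) * cnj (\<psi> (glue n A u v)))"

definition site1 :: "nat \<Rightarrow> nat \<Rightarrow> complex mat \<Rightarrow> nat \<times> nat \<Rightarrow> nat \<times> nat \<Rightarrow> complex" where
  "site1 d D V z z' = (\<Sum>a<d. V $$ (a * D + fst z, fst z') * cnj (V $$ (a * D + snd z, snd z')))"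

text \<open>The four components of a bond tuple belong to ket 1, ket 2, bra 1 and bra 2, in this
  order; \<open>z\<close> is the left bond and \<open>z'\<close> the right one. The flag says
  whether the site lies in A, where the bras exchange their physical labels.\<close>

definition site2 :: "nat \<Rightarrow> nat \<Rightarrow> bool \<Rightarrow> complex mat \<Rightarrow> ((nat \<times> nat) \<times> nat) \<times> nat \<Rightarrow> ((nat \<times> nat) \<times> nat) \<times> nat \<Rightarrow> complex" where
  "site2 d D \<tau> V z z' = (\<Sum>a<d. \<Sum>b<d.
     V $$ (a * D + fst (fst (fst z)), fst (fst (fst z'))) * V $$ (b * D + snd (fst (fst z)), snd (fst (fst z')))
     * cnj (V $$ ((if \<tau> then b else a) * D + snd (fst z), snd (fst z')))
     * cnj (V $$ ((if \<tau> then a else b) * D + snd z, snd z')))"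

abbreviation "bond2 D \<equiv> {..<D} \<times> {..<D}"
abbreviation "bond4 D \<equiv> (({..<D} \<times> {..<D}) \<times> {..<D}) \<times> {..<D}"

lemma sq_norm_mps_state:
  assumes "0 < n"
  shows "sq_norm_state d n (mps_state d n D U) = cyclic_sum n (bond2 D) (\<lambda>j. site1 d D (U j))"
proof -
  have "sq_norm_state d n (mps_state d n D U) = (\<Sum>x\<in>{..<n} \<rightarrow>\<^sub>E {..<d}. cyclic_sum n (bond2 D)
      (\<lambda>j z z'. U j $$ (x j * D + fst z, fst z') * cnj (U j $$ (x j * D + snd z, snd z'))))"
    unfolding sq_norm_state_def configs_def[symmetric]
  proof (rule sum.cong[OF refl])
    fix x assume x: "x \<in> configs d {..<n}"
    have "cnj (mps_state d n D U x) * mps_state d n D U x = mps_state d n D U x * cnj (mps_state d n D U x)"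
      by (rule mult.commute)
    also have "\<dots> = cyclic_sum n (bond2 D)
        (\<lambda>j z z'. U j $$ (x j * D + fst z, fst z') * cnj (U j $$ (x j * D + snd z, snd z')))"
      by (simp only: mps_state_eq[OF assms x] cnj_cyclic_sum cyclic_sum_mult)
    finally show "cnj (mps_state d n D U x) * mps_state d n D U x = cyclic_sum n (bond2 D)
        (\<lambda>j z z'. U j $$ (x j * D + fst z, fst z') * cnj (U j $$ (x j * D + snd z, snd z')))" .
  qed
  also have "\<dots> = cyclic_sum n (bond2 D) (\<lambda>j z z'. \<Sum>a<d. U j $$ (a * D + fst z, fst z') * cnj (U j $$ (a * D + snd z, snd z')))"
    using sum_PiE_cyclic_sum[where n = n and E = "bond2 D" and X = "{..<d}" and
      K = "\<lambda>j a z z'. U j $$ (a * D + fst z, fst z') * cnj (U j $$ (a * D + snd z, snd z'))"] by simp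
  also have "\<dots> = cyclic_sum n (bond2 D) (\<lambda>j. site1 d D (U j))"
    by (intro cyclic_sum_cong) (simp only: site1_def)
  finally show ?thesis .
qed

lemma purity_sum_mps_state:
  assumes "0 < n"
  shows "purity_sum d n A (mps_state d n D U) = cyclic_sum n (bond4 D) (\<lambda>j. site2 d D (j \<in> A) (U j))"
proof -
  define K where "K = (\<lambda>j a b z z'.
     U j $$ (a * D + fst (fst (fst z)), fst (fst (fst z'))) * U j $$ (b * D + snd (fst (fst z)), snd (fst (fst z')))
     * cnj (U j $$ ((if j \<in> A then b else a) * D + snd (fst z), snd (fst z')))
     * cnj (U j $$ ((if j \<in> A then a else b) * D + snd z, snd z')))"
  have "purity_sum d n A (mps_state d n D U)
    = (\<Sum>u\<in>{..<n} \<rightarrow>\<^sub>E {..<d}. \<Sum>v\<in>{..<n} \<rightarrow>\<^sub>E {..<d}. cyclic_sum n (bond4 D) (\<lambda>j. K j (u j) (v j)))"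
    unfolding purity_sum_def configs_def
  proof (intro sum.cong refl)
    fix u v assume uv: "u \<in> {..<n} \<rightarrow>\<^sub>E {..<d}" "v \<in> {..<n} \<rightarrow>\<^sub>E {..<d}"
    then have c: "u \<in> configs d {..<n}" "v \<in> configs d {..<n}" by (simp_all only: configs_def)
    have "mps_state d n D U u * mps_state d n D U v * cnj (mps_state d n D U (glue n A v u))
        * cnj (mps_state d n D U (glue n A u v)) = cyclic_sum n (bond4 D) (\<lambda>j z z'.
     U j $$ (u j * D + fst (fst (fst z)), fst (fst (fst z'))) * U j $$ (v j * D + snd (fst (fst z)), snd (fst (fst z')))
     * cnj (U j $$ (glue n A v u j * D + snd (fst z), snd (fst z')))
     * cnj (U j $$ (glue n A u v j * D + snd z, snd z')))"
      by (simp only: mps_state_eq[OF assms c(1)] mps_state_eq[OF assms c(2)]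
          mps_state_eq[OF assms glue_configs[OF c]] mps_state_eq[OF assms glue_configs[OF c(2,1)]]
          cnj_cyclic_sum cyclic_sum_mult)
    also have "\<dots> = cyclic_sum n (bond4 D) (\<lambda>j. K j (u j) (v j))"
      by (intro cyclic_sum_cong) (simp add: K_def glue_def)
    finally show "mps_state d n D U u * mps_state d n D U v * cnj (mps_state d n D U (glue n A v u))
        * cnj (mps_state d n D U (glue n A u v)) = cyclic_sum n (bond4 D) (\<lambda>j. K j (u j) (v j))" .
  qed
  also have "\<dots> = (\<Sum>u\<in>{..<n} \<rightarrow>\<^sub>E {..<d}. cyclic_sum n (bond4 D) (\<lambda>j z z'. \<Sum>b<d. K j (u j) b z z'))"
    by (intro sum.cong refl sum_PiE_cyclic_sum[where K = "\<lambda>j. K j (u j)" for u]) simp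
  also have "\<dots> = cyclic_sum n (bond4 D) (\<lambda>j z z'. \<Sum>a<d. \<Sum>b<d. K j a b z z')"
    by (intro sum_PiE_cyclic_sum[where K = "\<lambda>j a z z'. \<Sum>b<d. K j a b z z'"]) simp
  also have "\<dots> = cyclic_sum n (bond4 D) (\<lambda>j. site2 d D (j \<in> A) (U j))"
    by (intro cyclic_sum_cong) (simp only: site2_def K_def)
  finally show ?thesis .
qed

section \<open>Block indices and permutations of two replicas\<close>

lemma block_row_less:
  fixes a k d D :: nat
  assumes "a < d" "k < D"
  shows "a * D + k < d * D"
proof -
  have "a * D + k < Suc a * D" using assms(2) by simp
  also have "\<dots> \<le> d * D" using assms(1) by (intro mult_le_mono1) simp
  finally show ?thesis .
qed

lemma block_row_eq:
  fixes a b k h D :: nat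
  assumes "k < D" "h < D"
  shows "a * D + k = b * D + h \<longleftrightarrow> a = b \<and> k = h"
proof
  assume eq: "a * D + k = b * D + h"
  have "(a * D + k) div D = a" "(b * D + h) div D = b" using assms by simp_all
  then have "a = b" unfolding eq by simp
  then show "a = b \<and> k = h" using eq by simp
qed simp

text \<open>The permutations of two replicas are numbered 0 (the identity) and 1 (the transposition).\<close>

definition pairing :: "((nat \<times> nat) \<times> nat) \<times> nat \<Rightarrow> nat \<Rightarrow> complex" where
  "pairing z s = of_bool (if s = 0 then fst (fst (fst z)) = snd (fst z) \<and> snd (fst (fst z)) = snd z
     else fst (fst (fst z)) = snd z \<and> snd (fst (fst z)) = snd (fst z))"

text \<open>The Weingarten function of U(N) for two replicas: for N >= 2, the inverse of the 2 x 2
  matrix \<open>gram N\<close>.\<close>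

definition weingarten :: "nat \<Rightarrow> nat \<Rightarrow> nat \<Rightarrow> complex" where
  "weingarten N s r = (if s = r then 1 / (of_nat N ^ 2 - 1) else - 1 / (of_nat N * (of_nat N ^ 2 - 1)))"

text \<open>The dimension to the power of the number of cycles of the permutation relating
  \<open>s\<close> and \<open>r\<close>.\<close>

definition gram :: "nat \<Rightarrow> nat \<Rightarrow> nat \<Rightarrow> complex" where
  "gram D s r = (if s = r then of_nat D ^ 2 else of_nat D)"

text \<open>The first factor, from the sum over physical labels, compares \<open>s\<close> with the
  identity outside A and with the transposition inside A. The Haar average leads from
  \<open>s\<close> to \<open>r\<close>, and the bond to the next site compares \<open>r\<close> with
  the permutation \<open>t\<close> there.\<close>

definition transfer :: "nat \<Rightarrow> nat \<Rightarrow> bool \<Rightarrow> nat \<Rightarrow> nat \<Rightarrow> complex" where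
  "transfer d D \<tau> s t = gram d (of_bool \<tau>) s * (\<Sum>r<2. weingarten (d * D) s r * gram D r t)"

lemma sum_lessThan_2: "(\<Sum>i<2. f i) = f 0 + f (1::nat)"
  by (simp add: numeral_2_eq_2)

lemma sum_of_bool_eq:
  fixes k D :: nat
  shows "k < D \<Longrightarrow> (\<Sum>h<D. of_bool (k = h) * f h) = (f k :: complex)"
proof -
  assume k: "k < D"
  have "(\<Sum>h<D. of_bool (k = h) * f h) = (\<Sum>h<D. if h = k then f h else 0)"
    by (intro sum.cong) auto
  then show ?thesis using k by simp
qed

lemma sum_eq_card:
  assumes "finite S" "T \<subseteq> S" "\<And>z. z \<in> T \<Longrightarrow> f z = 1" "\<And>z. z \<in> S \<Longrightarrow> z \<notin> T \<Longrightarrow> f z = 0"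
  shows "sum f S = (of_nat (card T) :: complex)"
proof -
  have "sum f S = sum f T" using assms by (intro sum.mono_neutral_right) auto
  also have "\<dots> = (\<Sum>z\<in>T. 1)" using assms(3) by (intro sum.cong) auto
  finally show ?thesis by simp
qed

text \<open>A tuple obeying one pairing has two free components; obeying both pairings makes all
  four components equal.\<close>

lemma sum_pairing_pairing:
  assumes "s < 2" "r < 2"
  shows "(\<Sum>z\<in>bond4 D. pairing z s * pairing z r) = gram D s r"
proof (cases "s = r")
  case True
  define g where "g = (\<lambda>p::nat \<times> nat. ((p, if s = 0 then fst p else snd p), if s = 0 then snd p else fst p))"
  have inj: "inj_on g (bond2 D)" by (rule inj_onI) (simp only: g_def prod.inject)
  have 1: "pairing (g p) s = 1" for p
    by (cases "s = 0") (simp_all only: g_def pairing_def fst_conv snd_conv if_True if_False refl simp_thms of_bool_eq)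
  have 2: "z = g (fst (fst z))" if "pairing z s \<noteq> 0" for z
    using that by (cases "s = 0") (simp_all add: g_def pairing_def prod_eq_iff)
  have "(\<Sum>z\<in>bond4 D. pairing z s * pairing z s) = of_nat (card (g ` bond2 D))"
  proof (rule sum_eq_card)
    show "g ` bond2 D \<subseteq> bond4 D" by (auto simp: g_def)
  next
    fix z assume "z \<in> g ` bond2 D"
    then obtain p where "z = g p" by (rule imageE)
    then show "pairing z s * pairing z s = 1" using 1 by simp
  next
    fix z assume z: "z \<in> bond4 D" "z \<notin> g ` bond2 D"
    then have "fst (fst z) \<in> bond2 D" by (simp only: mem_Times_iff)
    then have "g (fst (fst z)) \<in> g ` bond2 D" by (rule imageI)
    then have "pairing z s = 0" using 2[of z] z(2) by metis
    then show "pairing z s * pairing z s = 0" by (simp only: mult_zero_left)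
  qed simp
  then show ?thesis using True by (simp add: card_image[OF inj] gram_def power2_eq_square)
next
  case False
  define g where "g = (\<lambda>k::nat. (((k, k), k), k))"
  have inj: "inj_on g {..<D}" by (rule inj_onI) (simp add: g_def)
  have "(\<Sum>z\<in>bond4 D. pairing z s * pairing z r) = of_nat (card (g ` {..<D}))"
  proof (rule sum_eq_card)
    show "g ` {..<D} \<subseteq> bond4 D" by (auto simp: g_def)
  next
    fix z assume "z \<in> g ` {..<D}"
    then obtain k where "z = g k" by (rule imageE)
    then show "pairing z s * pairing z r = 1" by (simp add: g_def pairing_def)
  next
    fix z assume z: "z \<in> bond4 D" "z \<notin> g ` {..<D}"
    have "z = g (snd z)" if "pairing z s \<noteq> 0" "pairing z r \<noteq> 0"
    proof -
      have "s = 0 \<or> r = 0" using False assms by linarith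
      then have "k' = k \<and> h = k \<and> h' = k"
        if "pairing (((k, k'), h), h') s \<noteq> 0" "pairing (((k, k'), h), h') r \<noteq> 0" for k k' h h'
        using that False by (elim disjE) (simp_all add: pairing_def)
      from this[of "fst (fst (fst z))" "snd (fst (fst z))" "snd (fst z)" "snd z"] that
      show ?thesis unfolding g_def prod.collapse by (metis prod.collapse)
    qed
    moreover have "g (snd z) \<in> g ` {..<D}" using z(1) by (intro imageI) (simp only: mem_Times_iff)
    ultimately show "pairing z s * pairing z r = 0" using z(2) by (metis mult_eq_0_iff)
  qed simp
  then show ?thesis using False by (simp add: card_image[OF inj] gram_def)
qed

lemma sum_diagonal: "(\<Sum>a<d. \<Sum>b<d. of_bool (a = b) * c) = of_nat d * (c :: complex)"
proof -
  have "(\<Sum>a<d. \<Sum>b<d. of_bool (a = b) * c) = (\<Sum>a<d. c)"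
    by (intro sum.cong refl sum_of_bool_eq) simp
  then show ?thesis by simp
qed

lemma sum_diagonal_or:
  "(\<Sum>a<d. \<Sum>b<d. of_bool (a = b \<or> P) * c) = (if P then of_nat d ^ 2 else of_nat d) * (c :: complex)"
proof (cases P)
  case True
  then show ?thesis by (simp add: power2_eq_square)
next
  case False
  then show ?thesis using sum_diagonal[where d = d and c = c] by simp
qed

section \<open>Averaged site kernels and the resulting expectations\<close>

locale haar_sites = haar "d * D" H for d D :: nat and H :: "complex mat measure" +
  fixes n :: nat
  assumes d: "2 \<le> d" and D: "1 \<le> D" and n: "1 \<le> n"
begin

lemma dim_ge_2: "2 \<le> d * D" using mult_le_mono[OF d D] by simp

lemma bond_less:
  assumes "k < D"
  shows "k < d * D"
proof -
  have "1 * D \<le> d * D" using d by (intro mult_le_mono1) simp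
  with assms show ?thesis by linarith
qed

lemma integrable_site1: "z \<in> bond2 D \<Longrightarrow> z' \<in> bond2 D \<Longrightarrow> integrable H (\<lambda>V. site1 d D V z z')"
  unfolding site1_def
  by (intro Bochner_Integration.integrable_sum integrable_entries1 block_row_less bond_less) auto

lemma integrable_site2: "z \<in> bond4 D \<Longrightarrow> z' \<in> bond4 D \<Longrightarrow> integrable H (\<lambda>V. site2 d D \<tau> V z z')"
  unfolding site2_def
  by (intro Bochner_Integration.integrable_sum integrable_entries2 block_row_less bond_less) auto

lemma integral_site1:
  assumes "z \<in> bond2 D" "z' \<in> bond2 D"
  shows "(LINT V|H. site1 d D V z z') = of_bool (fst z = snd z) * (of_bool (fst z' = snd z') / of_nat D)"
proof -
  have "(LINT V|H. site1 d D V z z')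
    = (\<Sum>a<d. moment1 (fst z') (snd z') (a * D + fst z) (a * D + snd z))"
    unfolding site1_def moment1_def using assms
    by (intro Bochner_Integration.integral_sum integrable_entries1 block_row_less bond_less) auto
  also have "\<dots> = (\<Sum>a<d. of_bool (fst z = snd z \<and> fst z' = snd z') / of_nat (d * D))"
    using assms by (intro sum.cong refl) (subst moment1_eq, auto intro: bond_less block_row_less)
  also have "\<dots> = of_bool (fst z = snd z) * (of_bool (fst z' = snd z') / of_nat D)"
    using d by simp
  finally show ?thesis .
qed

text \<open>The average is a sum of two products, each of a function of the left bond and a function
  of the right bond. This separation is what lets \<open>cyclic_sum_factor\<close> replace bond
  tuples by permutations.\<close>

lemma integral_site2:
  assumes z: "z \<in> bond4 D" "z' \<in> bond4 D"
  shows "(LINT V|H. site2 d D \<tau> V z z')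
    = (\<Sum>s<2. pairing z s * (gram d (of_bool \<tau>) s * (\<Sum>r<2. weingarten (d * D) s r * pairing z' r)))"
proof -
  define k k' h h' where "k = fst (fst (fst z))" and "k' = snd (fst (fst z))" and "h = snd (fst z)" and "h' = snd z"
  then have zk: "z = (((k, k'), h), h')" "k < D" "k' < D" "h < D" "h' < D"
    using z(1) by (auto simp: mem_Times_iff)
  define m m' s s' where "m = fst (fst (fst z'))" and "m' = snd (fst (fst z'))" and "s = snd (fst z')" and "s' = snd z'"
  then have zm: "z' = (((m, m'), s), s')" "m < D" "m' < D" "s < D" "s' < D"
    using z(2) by (auto simp: mem_Times_iff)
  have pair: "pairing z 0 = of_bool (k = h \<and> k' = h')" "pairing z 1 = of_bool (k = h' \<and> k' = h)"
    by (simp_all add: zk(1) pairing_def)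
  define Q where "Q = (\<lambda>i. \<Sum>r<2. weingarten (d * D) i r * pairing z' r)"
  have pair': "pairing z' 0 = of_bool (m = s \<and> m' = s')" "pairing z' 1 = of_bool (m = s' \<and> m' = s)"
    by (simp_all add: zm(1) pairing_def)
  let ?N = "of_nat (d * D) :: complex"
  have Q: "Q 0 = 1 / (?N\<^sup>2 - 1) * of_bool (m = s \<and> m' = s') + - 1 / (?N * (?N\<^sup>2 - 1)) * of_bool (m = s' \<and> m' = s)"
    "Q 1 = - 1 / (?N * (?N\<^sup>2 - 1)) * of_bool (m = s \<and> m' = s') + 1 / (?N\<^sup>2 - 1) * of_bool (m = s' \<and> m' = s)"
    unfolding Q_def sum_lessThan_2 pair' weingarten_def by simp_all
  have "(LINT V|H. site2 d D \<tau> V z z') = (\<Sum>a<d. \<Sum>b<d. moment2 m m' s s' (a * D + k) (b * D + k')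
      ((if \<tau> then b else a) * D + h) ((if \<tau> then a else b) * D + h'))"
    unfolding site2_def moment2_def zk(1) zm(1) fst_conv snd_conv using zk(2-) zm(2-)
    by (intro integral_sum_sum integrable_entries2 block_row_less bond_less) auto
  \<comment> \<open>Outside A the identity pairing leaves \<open>a\<close> and \<open>b\<close> free
    and the transposition forces a = b; inside A the roles are exchanged. The number of admissible
    pairs is d^2 or d, which is \<open>gram d\<close>.\<close>
  also have "\<dots> = (\<Sum>a<d. \<Sum>b<d. of_bool (a = b \<or> \<not> \<tau>) * (pairing z 0 * Q 0) + of_bool (a = b \<or> \<tau>) * (pairing z 1 * Q 1))"
  proof (intro sum.cong refl)
    fix a b assume "a \<in> {..<d}" "b \<in> {..<d}"
    then have ab: "a < d" "b < d" by simp_all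
    have eq: "moment2 m m' s s' (a * D + k) (b * D + k') (e * D + h) (f * D + h')
      = of_bool (a = e \<and> b = f) * (pairing z 0 * Q 0) + of_bool (a = f \<and> b = e) * (pairing z 1 * Q 1)"
      if "e < d" "f < d" for e f
    proof -
      have "moment2 m m' s s' (a * D + k) (b * D + k') (e * D + h) (f * D + h')
        = of_bool (a * D + k = e * D + h \<and> b * D + k' = f * D + h') * Q 0
        + of_bool (a * D + k = f * D + h' \<and> b * D + k' = e * D + h) * Q 1"
        unfolding Q using ab that zk(2-) zm(2-)
        by (intro moment2_eq bond_less block_row_less dim_ge_2)
      moreover have "(a * D + k = e * D + h \<and> b * D + k' = f * D + h') = ((a = e \<and> b = f) \<and> (k = h \<and> k' = h'))"
        "(a * D + k = f * D + h' \<and> b * D + k' = e * D + h) = ((a = f \<and> b = e) \<and> (k = h' \<and> k' = h))"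
        using zk(2-) by (simp_all only: block_row_eq conj_ac)
      ultimately show ?thesis by (simp only: pair of_bool_conj mult.assoc)
    qed
    show "moment2 m m' s s' (a * D + k) (b * D + k') ((if \<tau> then b else a) * D + h) ((if \<tau> then a else b) * D + h')
      = of_bool (a = b \<or> \<not> \<tau>) * (pairing z 0 * Q 0) + of_bool (a = b \<or> \<tau>) * (pairing z 1 * Q 1)"
    proof (cases \<tau>)
      case True
      then show ?thesis by (simp only: if_True eq[OF ab(2,1)]) (simp only: simp_thms eq_commute[of b a])
    next
      case False
      then show ?thesis by (simp only: if_False eq[OF ab(1,2)]) (simp only: simp_thms eq_commute[of b a])
    qed
  qed
  also have "\<dots> = gram d (of_bool \<tau>) 0 * (pairing z 0 * Q 0) + gram d (of_bool \<tau>) 1 * (pairing z 1 * Q 1)"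
    unfolding sum.distrib sum_diagonal_or by (simp only: gram_def) simp
  also have "\<dots> = (\<Sum>i<2. pairing z i * (gram d (of_bool \<tau>) i * Q i))"
    unfolding sum_lessThan_2 by (simp only: mult_ac)
  finally show ?thesis by (simp add: Q_def)
qed

abbreviation "sites \<equiv> Pi\<^sub>M {..<n} (\<lambda>_. H)"

lemma integrable_sq_norm: "integrable sites (\<lambda>U. sq_norm_state d n (mps_state d n D U))"
proof -
  have n0: "0 < n" using n by simp
  show ?thesis
    unfolding sq_norm_mps_state[OF n0] using integrable_site1 by (intro cyclic_sum_integral(1)[OF n0])
qed

lemma integrable_purity_sum: "integrable sites (\<lambda>U. purity_sum d n A (mps_state d n D U))"
proof -
  have n0: "0 < n" using n by simp
  show ?thesis
    unfolding purity_sum_mps_state[OF n0] using integrable_site2 by (intro cyclic_sum_integral(1)[OF n0])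
qed

lemma integral_sq_norm: "(LINT U|sites. sq_norm_state d n (mps_state d n D U)) = 1"
proof -
  have n0: "0 < n" using n by simp
  have "(LINT U|sites. sq_norm_state d n (mps_state d n D U))
    = cyclic_sum n (bond2 D) (\<lambda>j z z'. LINT V|H. site1 d D V z z')"
    unfolding sq_norm_mps_state[OF n0] using integrable_site1 by (intro cyclic_sum_integral(2)[OF n0])
  \<comment> \<open>The averaged kernel is a single product, written as a sum over a one-element set
    so that \<open>cyclic_sum_factor\<close> yields a 1 x 1 transfer matrix with entry 1.\<close>
  also have "\<dots> = cyclic_sum n (bond2 D) (\<lambda>j z z'. \<Sum>s\<in>{()}. of_bool (fst z = snd z) * (of_bool (fst z' = snd z') / of_nat D))"
    by (intro cyclic_sum_cong) (simp add: integral_site1)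
  also have "\<dots> = cyclic_sum n {()} (\<lambda>j s t. \<Sum>z\<in>bond2 D. of_bool (fst z = snd z) / of_nat D * of_bool (fst z = snd z))"
    by (rule cyclic_sum_factor[OF n0, where L = "\<lambda>j z s. of_bool (fst z = snd z)"
          and R = "\<lambda>j s z. of_bool (fst z = snd z) / of_nat D"]) auto
  also have "\<dots> = cyclic_sum n {()} (\<lambda>j s t. 1)"
  proof (intro cyclic_sum_cong)
    have "(\<Sum>z\<in>bond2 D. of_bool (fst z = snd z) / of_nat D * of_bool (fst z = snd z) :: complex)
      = (\<Sum>k<D. \<Sum>h<D. of_bool (k = h) * (1 / of_nat D))"
      unfolding sum.cartesian_product by (intro sum.cong refl) auto
    also have "\<dots> = 1" unfolding sum_diagonal using D by simp
    finally show "(\<Sum>z\<in>bond2 D. of_bool (fst z = snd z) / of_nat D * of_bool (fst z = snd z) :: complex) = 1" .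
  qed
  also have "\<dots> = 1" by (simp add: cyclic_sum_def card_PiE)
  finally show ?thesis .
qed

lemma integral_purity_sum:
  "(LINT U|sites. purity_sum d n A (mps_state d n D U)) = cyclic_sum n {..<2} (\<lambda>j. transfer d D (j \<in> A))"
proof -
  have n0: "0 < n" using n by simp
  let ?R = "\<lambda>j s z. gram d (of_bool (j \<in> A)) s * (\<Sum>r<2. weingarten (d * D) s r * pairing z r)"
  have "(LINT U|sites. purity_sum d n A (mps_state d n D U))
    = cyclic_sum n (bond4 D) (\<lambda>j z z'. LINT V|H. site2 d D (j \<in> A) V z z')"
    unfolding purity_sum_mps_state[OF n0] using integrable_site2 by (intro cyclic_sum_integral(2)[OF n0])
  also have "\<dots> = cyclic_sum n (bond4 D) (\<lambda>j z z'. \<Sum>s<2. pairing z s * ?R j s z')"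
    by (intro cyclic_sum_cong integral_site2)
  also have "\<dots> = cyclic_sum n {..<2} (\<lambda>j s t. \<Sum>z\<in>bond4 D. ?R j s z * pairing z t)"
    by (rule cyclic_sum_factor[OF n0, where L = "\<lambda>j z s. pairing z s" and R = ?R]) auto
  also have "\<dots> = cyclic_sum n {..<2} (\<lambda>j. transfer d D (j \<in> A))"
  proof (intro cyclic_sum_cong)
    fix j s t :: nat assume t: "t \<in> {..<2}"
    have "(\<Sum>z\<in>bond4 D. ?R j s z * pairing z t)
      = gram d (of_bool (j \<in> A)) s * (\<Sum>z\<in>bond4 D. \<Sum>r<2. weingarten (d * D) s r * (pairing z r * pairing z t))"
      by (simp add: sum_distrib_left sum_distrib_right mult_ac)
    also have "(\<Sum>z\<in>bond4 D. \<Sum>r<2. weingarten (d * D) s r * (pairing z r * pairing z t))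
      = (\<Sum>r<2. weingarten (d * D) s r * gram D r t)"
      using t by (subst sum.swap) (simp add: sum_distrib_left[symmetric] sum_pairing_pairing)
    finally show "(\<Sum>z\<in>bond4 D. ?R j s z * pairing z t) = transfer d D (j \<in> A) s t"
      by (simp add: transfer_def)
  qed
  finally show ?thesis .
qed

end

section \<open>The transfer matrices\<close>

lemma mat2_mult_index:
  assumes "A \<in> carrier_mat 2 2" "B \<in> carrier_mat 2 2" "i < 2" "j < 2"
  shows "(A * B) $$ (i, j) = A $$ (i, 0) * B $$ (0, j) + A $$ (i, 1) * B $$ (1, j)"
proof -
  have "(A * B) $$ (i, j) = (\<Sum>k<2. A $$ (i, k) * B $$ (k, j))"
    using assms by (simp add: scalar_prod_def atLeast0LessThan)
  then show ?thesis by (simp only: sum_lessThan_2)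
qed

lemma less_2_nat: "(0::nat) < 2" "(1::nat) < 2"
  by simp_all

lemma mat2_eqI:
  assumes "A \<in> carrier_mat 2 2" "B \<in> carrier_mat 2 2"
    and "A $$ (0, 0) = B $$ (0, 0)" "A $$ (0, 1) = B $$ (0, 1)"
    and "A $$ (1, 0) = B $$ (1, 0)" "A $$ (1, 1) = B $$ (1, 1)"
  shows "A = B"
proof (rule eq_matI)
  fix i j assume "i < dim_row B" "j < dim_col B"
  then have "i = 0 \<or> i = 1" "j = 0 \<or> j = 1" using assms(2) by auto
  then show "A $$ (i, j) = B $$ (i, j)" using assms(3-6) by (elim disjE) (simp_all only:)
qed (use assms(1,2) in auto)

lemma mat2_trace:
  assumes "A \<in> carrier_mat 2 2"
  shows "mat_trace A = A $$ (0, 0) + A $$ (1, 1)"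
  using assms unfolding mat_trace_def by (simp add: sum_lessThan_2)

text \<open>The matrix with eigenvalue 1 on the rank one projection
  \<open>[[c D\<^sup>2, c D], [D, 1]] / (c D\<^sup>2 + 1)\<close> and eigenvalue \<open>x\<close> on the complementary one; the flag
  exchanges the two basis vectors.\<close>

definition eigen_mat :: "complex \<Rightarrow> complex \<Rightarrow> bool \<Rightarrow> complex \<Rightarrow> complex mat" where
  "eigen_mat c D \<tau> x = mat 2 2 (\<lambda>(s, t).
     (if (s = 0) = \<tau> then (if (t = 0) = \<tau> then 1 + x * c * D\<^sup>2 else D * (1 - x))
      else (if (t = 0) = \<tau> then c * D * (1 - x) else c * D\<^sup>2 + x)) / (c * D\<^sup>2 + 1))"

lemma eigen_mat_carrier: "eigen_mat c D \<tau> x \<in> carrier_mat 2 2"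
  by (simp add: eigen_mat_def)

lemma eigen_mat_index:
  "eigen_mat c D False x $$ (0, 0) = (c * D\<^sup>2 + x) * (1 / (c * D\<^sup>2 + 1))"
  "eigen_mat c D False x $$ (0, 1) = c * D * (1 - x) * (1 / (c * D\<^sup>2 + 1))"
  "eigen_mat c D False x $$ (1, 0) = D * (1 - x) * (1 / (c * D\<^sup>2 + 1))"
  "eigen_mat c D False x $$ (1, 1) = (1 + x * c * D\<^sup>2) * (1 / (c * D\<^sup>2 + 1))"
  "eigen_mat c D True x $$ (0, 0) = (1 + x * c * D\<^sup>2) * (1 / (c * D\<^sup>2 + 1))"
  "eigen_mat c D True x $$ (0, 1) = D * (1 - x) * (1 / (c * D\<^sup>2 + 1))"
  "eigen_mat c D True x $$ (1, 0) = c * D * (1 - x) * (1 / (c * D\<^sup>2 + 1))"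
  "eigen_mat c D True x $$ (1, 1) = (c * D\<^sup>2 + x) * (1 / (c * D\<^sup>2 + 1))"
  by (simp_all add: eigen_mat_def)

text \<open>The two eigenprojections do not depend on \<open>x\<close>, so only the eigenvalues
  multiply; powers of a transfer matrix become powers of \<open>x\<close>.\<close>

lemma eigen_mat_mult:
  assumes "c * D\<^sup>2 + 1 \<noteq> 0"
  shows "eigen_mat c D \<tau> x * eigen_mat c D \<tau> y = eigen_mat c D \<tau> (x * y)"
proof -
  define r where "r = 1 / (c * D\<^sup>2 + 1)"
  have r: "r * (c * D\<^sup>2 + 1) = 1" using assms by (simp add: r_def)
  have key: "(A * r) * (B * r) + (A' * r) * (B' * r) = C * r" if "A * B + A' * B' = (c * D\<^sup>2 + 1) * C" for A B A' B' C
  proof -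
    have "(A * r) * (B * r) + (A' * r) * (B' * r) = (A * B + A' * B') * r * r" by (simp add: algebra_simps)
    also have "\<dots> = C * r * (r * (c * D\<^sup>2 + 1))" unfolding that by (simp only: mult_ac)
    finally show ?thesis unfolding r by simp
  qed
  note I = eigen_mat_index[of c D, folded r_def] mat2_mult_index[OF eigen_mat_carrier eigen_mat_carrier]
    less_2_nat
  show ?thesis
  proof (rule mat2_eqI)
    show "eigen_mat c D \<tau> x * eigen_mat c D \<tau> y \<in> carrier_mat 2 2"
      by (rule mult_carrier_mat[OF eigen_mat_carrier eigen_mat_carrier])
    show "(eigen_mat c D \<tau> x * eigen_mat c D \<tau> y) $$ (0, 0) = eigen_mat c D \<tau> (x * y) $$ (0, 0)"
      by (cases \<tau>; simp only: I; rule key; simp add: algebra_simps power2_eq_square)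
    show "(eigen_mat c D \<tau> x * eigen_mat c D \<tau> y) $$ (0, 1) = eigen_mat c D \<tau> (x * y) $$ (0, 1)"
      by (cases \<tau>; simp only: I; rule key; simp add: algebra_simps power2_eq_square)
    show "(eigen_mat c D \<tau> x * eigen_mat c D \<tau> y) $$ (1, 0) = eigen_mat c D \<tau> (x * y) $$ (1, 0)"
      by (cases \<tau>; simp only: I; rule key; simp add: algebra_simps power2_eq_square)
    show "(eigen_mat c D \<tau> x * eigen_mat c D \<tau> y) $$ (1, 1) = eigen_mat c D \<tau> (x * y) $$ (1, 1)"
      by (cases \<tau>; simp only: I; rule key; simp add: algebra_simps power2_eq_square)
  qed (rule eigen_mat_carrier)
qed

lemma eigen_mat_1:
  assumes "c * D\<^sup>2 + 1 \<noteq> 0"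
  shows "eigen_mat c D \<tau> 1 = 1\<^sub>m 2"
proof -
  have q: "1 + c * D\<^sup>2 \<noteq> 0" using assms by (simp only: add.commute not_False_eq_True)
  have 1: "(1 + 1 * c * D\<^sup>2) * (1 / (c * D\<^sup>2 + 1)) = 1" "(c * D\<^sup>2 + 1) * (1 / (c * D\<^sup>2 + 1)) = 1"
    using q assms by (simp_all only: mult_1_left add.commute[of "c * D\<^sup>2" 1]) simp_all
  have 0: "z * (1 - 1) * w = 0" for z w :: complex by simp
  have o: "1\<^sub>m 2 $$ (0, 0) = (1 :: complex)" "1\<^sub>m 2 $$ (0, 1) = (0 :: complex)"
    "1\<^sub>m 2 $$ (1, 0) = (0 :: complex)" "1\<^sub>m 2 $$ (1, 1) = (1 :: complex)" by simp_all
  show ?thesis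
    by (rule mat2_eqI[OF eigen_mat_carrier one_carrier_mat]; cases \<tau>; simp only: eigen_mat_index 0 1 o)
qed

lemma foldr_eigen_mat:
  assumes "c * D\<^sup>2 + 1 \<noteq> 0" "Z \<in> carrier_mat 2 2"
  shows "foldr (*) (map (\<lambda>_. eigen_mat c D \<tau> x) xs) Z = eigen_mat c D \<tau> (x ^ length xs) * Z"
proof (induction xs)
  case Nil
  then show ?case using assms by (simp add: eigen_mat_1)
next
  case (Cons a xs)
  have "eigen_mat c D \<tau> x * (eigen_mat c D \<tau> (x ^ length xs) * Z)
      = (eigen_mat c D \<tau> x * eigen_mat c D \<tau> (x ^ length xs)) * Z"
    by (rule assoc_mult_mat[symmetric, OF eigen_mat_carrier eigen_mat_carrier assms(2)])
  then show ?case using Cons by (simp add: eigen_mat_mult[OF assms(1)])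
qed

text \<open>With P and Q the projections for eigenvalue 1 of the two matrices, t = Tr(P Q). As both
  have rank 1 in dimension 2, Tr(P (1 - Q)) = Tr((1 - P) Q) = 1 - t and Tr((1 - P) (1 - Q)) =
  t.\<close>

lemma eigen_mat_trace:
  assumes "c * D\<^sup>2 + 1 \<noteq> 0"
  defines "t \<equiv> D\<^sup>2 * (c + 1)\<^sup>2 / (c * D\<^sup>2 + 1)\<^sup>2"
  shows "mat_trace (eigen_mat c D True x * eigen_mat c D False y) = t + (1 - t) * (x + y) + t * (x * y)"
proof -
  define r where "r = 1 / (c * D\<^sup>2 + 1)"
  have r: "r * (c * D\<^sup>2 + 1) = 1" using assms by (simp add: r_def)
  have t: "t = D\<^sup>2 * (c + 1)\<^sup>2 * r\<^sup>2" by (simp add: t_def r_def power_divide)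
  have "mat_trace (eigen_mat c D True x * eigen_mat c D False y)
    = (1 + x * c * D\<^sup>2) * r * ((c * D\<^sup>2 + y) * r) + D * (1 - x) * r * (D * (1 - y) * r)
    + (c * D * (1 - x) * r * (c * D * (1 - y) * r) + (c * D\<^sup>2 + x) * r * ((1 + y * c * D\<^sup>2) * r))"
    unfolding mat2_trace[OF mult_carrier_mat[OF eigen_mat_carrier eigen_mat_carrier]]
    by (simp only: mat2_mult_index[OF eigen_mat_carrier eigen_mat_carrier] less_2_nat eigen_mat_index[of c D, folded r_def])
  also have "\<dots> = (D\<^sup>2 * (c + 1)\<^sup>2 + ((c * D\<^sup>2 + 1)\<^sup>2 - D\<^sup>2 * (c + 1)\<^sup>2) * (x + y) + D\<^sup>2 * (c + 1)\<^sup>2 * (x * y)) * r\<^sup>2"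
    by (simp add: algebra_simps power2_eq_square)
  also have "\<dots> = t + ((r * (c * D\<^sup>2 + 1))\<^sup>2 - t) * (x + y) + t * (x * y)"
    unfolding t power_mult_distrib by (simp add: algebra_simps)
  finally show ?thesis unfolding r by simp
qed

definition subleading :: "nat \<Rightarrow> nat \<Rightarrow> real" where
  "subleading d D = real d * (real D ^ 2 - 1) / (real d ^ 2 * real D ^ 2 - 1)"

lemma transfer_eigen_mat:
  assumes d: "2 \<le> d" and D: "1 \<le> D"
  shows "mat 2 2 (\<lambda>(s, t). transfer d D \<tau> s t)
    = eigen_mat (of_nat d) (of_nat D) \<tau> (of_real (subleading d D))"
proof -
  let ?c = "of_nat d :: complex" and ?D = "of_nat D :: complex"
  define r where "r = 1 / (?c * ?D\<^sup>2 + 1)"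
  define v where "v = 1 / (?c\<^sup>2 * ?D\<^sup>2 - 1)"
  have "?c * ?D\<^sup>2 + 1 = of_nat (d * D\<^sup>2 + 1)" by simp
  then have "?c * ?D\<^sup>2 + 1 \<noteq> 0" by (metis of_nat_eq_0_iff add_is_0 one_neq_zero)
  then have r: "r * (?c * ?D\<^sup>2 + 1) = 1" by (simp add: r_def)
  have nz: "?c \<noteq> 0" "?D \<noteq> 0" using assms by auto
  have "1 < (d * D)\<^sup>2" using mult_le_mono[OF d D] by (intro one_less_power) auto
  then have "(d * D)\<^sup>2 \<noteq> 1" by (rule less_imp_neq[THEN not_sym])
  then have "of_nat ((d * D)\<^sup>2) \<noteq> (1 :: complex)" by (metis of_nat_eq_1_iff)
  then have "?c\<^sup>2 * ?D\<^sup>2 - 1 \<noteq> 0" by (simp add: power_mult_distrib)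
  then have v: "v * (?c\<^sup>2 * ?D\<^sup>2 - 1) = 1" by (simp add: v_def)
  have x: "complex_of_real (subleading d D) = ?c * (?D\<^sup>2 - 1) * v"
    by (simp add: subleading_def v_def)
  have w: "weingarten (d * D) s s = v" "s \<noteq> s' \<Longrightarrow> weingarten (d * D) s s' = - v / (?c * ?D)" for s s'
    by (simp_all add: weingarten_def v_def power_mult_distrib)
  have g: "gram e s s = (of_nat e)\<^sup>2" "s \<noteq> s' \<Longrightarrow> gram e s s' = of_nat e" for e s s'
    by (simp_all add: gram_def)
  have T: "transfer d D False 0 0 = v * (?c\<^sup>2 * ?D\<^sup>2 - ?c)"
    "transfer d D False 0 1 = v * (?c\<^sup>2 * ?D - ?c * ?D)"
    "transfer d D False 1 0 = v * (?c * ?D - ?D)"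
    "transfer d D False 1 1 = v * (?c * ?D\<^sup>2 - 1)"
    "transfer d D True 0 0 = v * (?c * ?D\<^sup>2 - 1)"
    "transfer d D True 0 1 = v * (?c * ?D - ?D)"
    "transfer d D True 1 0 = v * (?c\<^sup>2 * ?D - ?c * ?D)"
    "transfer d D True 1 1 = v * (?c\<^sup>2 * ?D\<^sup>2 - ?c)"
    unfolding transfer_def sum_lessThan_2 w(1) w(2)[OF zero_neq_one] w(2)[OF one_neq_zero] of_bool_eq
      g(1) g(2)[OF zero_neq_one] g(2)[OF one_neq_zero]
    using nz by (simp_all add: field_simps power2_eq_square)
  \<comment> \<open>Both denominators are cleared here: \<open>r\<close> and \<open>v\<close> invert
    c D^2 + 1 and c^2 D^2 - 1, and each entry, of the form (E + X x) r, is reduced to a polynomial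
    identity in c and D.\<close>
  have key: "v * P = (E + X * (?c * (?D\<^sup>2 - 1) * v)) * r"
    if "P * (?c * ?D\<^sup>2 + 1) = E * (?c\<^sup>2 * ?D\<^sup>2 - 1) + X * (?c * (?D\<^sup>2 - 1))" for P E X
  proof -
    have "v * P = (P * (?c * ?D\<^sup>2 + 1)) * v * r" using r by (simp add: mult_ac)
    also have "\<dots> = (E * (v * (?c\<^sup>2 * ?D\<^sup>2 - 1)) + X * (?c * (?D\<^sup>2 - 1) * v)) * r"
      unfolding that by (simp add: algebra_simps)
    finally show ?thesis unfolding v by simp
  qed
  have K: "v * (?c\<^sup>2 * ?D\<^sup>2 - ?c) = (?c * ?D\<^sup>2 + ?c * (?D\<^sup>2 - 1) * v) * r"
    "v * (?c\<^sup>2 * ?D - ?c * ?D) = ?c * ?D * (1 - ?c * (?D\<^sup>2 - 1) * v) * r"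
    "v * (?c * ?D - ?D) = ?D * (1 - ?c * (?D\<^sup>2 - 1) * v) * r"
    "v * (?c * ?D\<^sup>2 - 1) = (1 + ?c * (?D\<^sup>2 - 1) * v * ?c * ?D\<^sup>2) * r"
    using key[of "?c\<^sup>2 * ?D\<^sup>2 - ?c" "?c * ?D\<^sup>2" 1]
      key[of "?c\<^sup>2 * ?D - ?c * ?D" "?c * ?D" "- ?c * ?D"] key[of "?c * ?D - ?D" "?D" "- ?D"]
      key[of "?c * ?D\<^sup>2 - 1" 1 "?c * ?D\<^sup>2"]
    by (simp_all add: algebra_simps power2_eq_square)
  have M: "mat 2 2 (\<lambda>(s, t). transfer d D \<tau> s t) $$ (i, j) = transfer d D \<tau> i j" if "i < 2" "j < 2" for i j
    using that by simp
  have E: "transfer d D \<tau> 0 0 = eigen_mat ?c ?D \<tau> (?c * (?D\<^sup>2 - 1) * v) $$ (0, 0)"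
    "transfer d D \<tau> 0 1 = eigen_mat ?c ?D \<tau> (?c * (?D\<^sup>2 - 1) * v) $$ (0, 1)"
    "transfer d D \<tau> 1 0 = eigen_mat ?c ?D \<tau> (?c * (?D\<^sup>2 - 1) * v) $$ (1, 0)"
    "transfer d D \<tau> 1 1 = eigen_mat ?c ?D \<tau> (?c * (?D\<^sup>2 - 1) * v) $$ (1, 1)"
    by (cases \<tau>; simp only: T K eigen_mat_index[of ?c ?D, folded r_def])+
  show ?thesis
    unfolding x
    by (rule mat2_eqI; simp only: M less_2_nat E eigen_mat_carrier mat_carrier)
qed

context haar_sites
begin

text \<open>Rotating the start of the run to 0 turns A into the first \<open>l\<close> sites, so the
  ordered product is one power of the inside matrix times one power of the outside matrix. Runs that
  wrap around are covered by the same argument.\<close>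

lemma integral_purity_sum_consecutive:
  assumes l: "l \<le> n" and a: "a < n" and A: "A = (\<lambda>k. (a + k) mod n) ` {..<l}"
  defines "t \<equiv> real D ^ 2 * (real d + 1) ^ 2 / (real d * real D ^ 2 + 1) ^ 2"
    and "x \<equiv> subleading d D"
  shows "(LINT U|sites. purity_sum d n A (mps_state d n D U))
    = of_real (t + (1 - t) * (x ^ l + x ^ (n - l)) + t * x ^ n)"
proof -
  let ?c = "of_nat d :: complex" and ?D = "of_nat D :: complex"
  have "?c * ?D\<^sup>2 + 1 = of_nat (d * D\<^sup>2 + 1)" by simp
  then have q: "?c * ?D\<^sup>2 + 1 \<noteq> 0" by (metis of_nat_eq_0_iff add_is_0 one_neq_zero)
  define T where "T = (\<lambda>\<tau>. mat 2 2 (\<lambda>(s, t). transfer d D \<tau> s t))"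
  have T: "T \<tau> = eigen_mat ?c ?D \<tau> (of_real x)" for \<tau>
    unfolding T_def x_def by (rule transfer_eigen_mat[OF d D])
  have n0: "0 < n" using n by simp
  have mem: "(a + j) mod n \<in> A \<longleftrightarrow> j < l" if "j < n" for j
  proof -
    have inj: "inj_on (\<lambda>j. (a + j) mod n) {..<n}"
      using bij_betw_add_mod[OF n0] by (rule bij_betw_imp_inj_on)
    have "(a + j) mod n \<in> A \<longleftrightarrow> j \<in> {..<l}"
      unfolding A using that l by (intro inj_on_image_mem_iff[OF inj]) auto
    then show ?thesis by simp
  qed
  have "(LINT U|sites. purity_sum d n A (mps_state d n D U))
      = cyclic_sum n {..<2} (\<lambda>j. transfer d D ((a + j) mod n \<in> A))"
    unfolding integral_purity_sum
    by (rule cyclic_sum_rotate[OF n0 finite_lessThan, symmetric, where K = "\<lambda>j. transfer d D (j \<in> A)"])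
  also have "\<dots> = cyclic_sum n {..<2} (\<lambda>j p q. T (j < l) $$ (p, q))"
    using mem by (intro cyclic_sum_cong) (simp add: T_def)
  also have "\<dots> = mat_trace (foldr (*) (map (\<lambda>j. T (j < l)) [0..<n]) (1\<^sub>m 2))"
    by (rule mat_trace_foldr[OF n0, symmetric]) (simp add: T_def)
  also have "[0..<n] = [0..<l] @ [l..<n]" using upt_add_eq_append[of 0 l "n - l"] l by simp
  also have "map (\<lambda>j. T (j < l)) ([0..<l] @ [l..<n]) = map (\<lambda>_. T True) [0..<l] @ map (\<lambda>_. T False) [l..<n]"
    by simp
  also have "foldr (*) \<dots> (1\<^sub>m 2) = eigen_mat ?c ?D True (of_real x ^ l) * eigen_mat ?c ?D False (of_real x ^ (n - l))"
    unfolding T foldr_append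
    by (simp add: foldr_eigen_mat[OF q] mult_carrier_mat[OF eigen_mat_carrier] right_mult_one_mat[OF eigen_mat_carrier]
        eigen_mat_carrier)
  also have "mat_trace \<dots> = of_real (t + (1 - t) * (x ^ l + x ^ (n - l)) + t * (x ^ l * x ^ (n - l)))"
    unfolding eigen_mat_trace[OF q] t_def by simp
  also have "x ^ l * x ^ (n - l) = x ^ n" using l by (simp add: power_add[symmetric])
  finally show ?thesis .
qed

end

section \<open>Purity of the reduced state\<close>

lemma sum_configs_split:
  fixes f :: "(nat \<Rightarrow> nat) \<Rightarrow> complex"
  assumes "A \<subseteq> {..<n}"
  defines "B \<equiv> {..<n} - A"
  shows "(\<Sum>u\<in>configs d {..<n}. f u) = (\<Sum>x\<in>configs d A. \<Sum>z\<in>configs d B. f (merge A B (x, z)))"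
proof -
  have AB: "A \<inter> B = {}" "A \<union> B = {..<n}" using assms by auto
  have "bij_betw (merge A B) (configs d A \<times> configs d B) (configs d {..<n})"
  proof (rule bij_betw_byWitness[where f' = "\<lambda>u. (restrict u A, restrict u B)"])
    show "\<forall>p\<in>configs d A \<times> configs d B. (restrict (merge A B p) A, restrict (merge A B p) B) = p"
    proof
      fix p assume "p \<in> configs d A \<times> configs d B"
      then obtain x z where p: "p = (x, z)" "x \<in> A \<rightarrow>\<^sub>E {..<d}" "z \<in> B \<rightarrow>\<^sub>E {..<d}"
        unfolding configs_def by (rule SigmaE)
      have "restrict (merge A B (x, z)) A = x"
        by (rule restrict_eq_PiE[OF p(2)]) (simp only: merge_def case_prod_conv if_True)
      moreover have "restrict (merge A B (x, z)) B = z"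
        by (rule restrict_eq_PiE[OF p(3)]) (use AB(1) in \<open>auto simp: merge_def\<close>)
      ultimately show "(restrict (merge A B p) A, restrict (merge A B p) B) = p" by (simp only: p(1))
    qed
    show "\<forall>u\<in>configs d {..<n}. merge A B (restrict u A, restrict u B) = u"
    proof
      fix u assume u: "u \<in> configs d {..<n}"
      show "merge A B (restrict u A, restrict u B) = u"
      proof
        fix i
        have "u i = undefined" if "i \<notin> A" "i \<notin> B"
          using that AB(2) PiE_arb[OF u[unfolded configs_def], of i] by blast
        then show "merge A B (restrict u A, restrict u B) i = u i" by (simp add: merge_def)
      qed
    qed
    show "merge A B ` (configs d A \<times> configs d B) \<subseteq> configs d {..<n}"
    proof (rule image_subsetI)
      fix p assume "p \<in> configs d A \<times> configs d B"
      then obtain x z where p: "p = (x, z)" "x \<in> A \<rightarrow>\<^sub>E {..<d}" "z \<in> B \<rightarrow>\<^sub>E {..<d}"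
        unfolding configs_def by (rule SigmaE)
      show "merge A B p \<in> configs d {..<n}"
        unfolding configs_def p(1)
      proof (rule PiE_I)
        fix i assume "i \<in> {..<n}"
        then have "i \<in> A \<or> i \<notin> A \<and> i \<in> B" using AB(2) by blast
        then show "merge A B (x, z) i \<in> {..<d}"
          using PiE_mem[OF p(2), of i] PiE_mem[OF p(3), of i]
          by (elim disjE conjE) (simp_all only: merge_def case_prod_conv if_True if_False)
      next
        fix i assume "i \<notin> {..<n}"
        then have "i \<notin> A" "i \<notin> B" using AB(2) by blast+
        then show "merge A B (x, z) i = undefined" by (simp only: merge_def case_prod_conv if_False)
      qed
    qed
    show "(\<lambda>u. (restrict u A, restrict u B)) ` configs d {..<n} \<subseteq> configs d A \<times> configs d B"
    proof (rule image_subsetI)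
      fix u assume "u \<in> configs d {..<n}"
      then have u: "u \<in> {..<n} \<rightarrow>\<^sub>E {..<d}" by (simp only: configs_def)
      have "u i \<in> {..<d}" if "i \<in> A \<union> B" for i
        using that unfolding AB(2) by (rule PiE_mem[OF u])
      then have "\<forall>i\<in>A. u i \<in> {..<d}" "\<forall>i\<in>B. u i \<in> {..<d}" by blast+
      then show "(restrict u A, restrict u B) \<in> configs d A \<times> configs d B"
        unfolding configs_def by (intro SigmaI) (simp_all only: restrict_PiE_iff)
    qed
  qed
  then have "(\<Sum>p\<in>configs d A \<times> configs d B. f (merge A B p)) = (\<Sum>u\<in>configs d {..<n}. f u)"
    by (rule sum.reindex_bij_betw)
  then show ?thesis unfolding sum.cartesian_product' by (rule sym)
qed

lemma finite_configs: "finite S \<Longrightarrow> finite (configs d S)"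
  unfolding configs_def by (intro finite_PiE) auto

lemma card_configs: "finite S \<Longrightarrow> card (configs d S) = d ^ card S"
  unfolding configs_def by (simp add: card_PiE)

lemma glue_merge:
  assumes "A \<subseteq> {..<n}"
  defines "B \<equiv> {..<n} - A"
  shows "glue n A (merge A B (y, w)) (merge A B (x, z)) = merge A B (y, z)"
proof
  fix i
  show "glue n A (merge A B (y, w)) (merge A B (x, z)) i = merge A B (y, z) i"
    using assms by (cases "i \<in> A"; cases "i \<in> B") (auto simp: glue_def merge_def B_def)
qed

definition unnormalized_density :: "nat \<Rightarrow> nat \<Rightarrow> nat set \<Rightarrow> ((nat \<Rightarrow> nat) \<Rightarrow> complex) \<Rightarrow>
    (nat \<Rightarrow> nat) \<Rightarrow> (nat \<Rightarrow> nat) \<Rightarrow> complex" where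
  "unnormalized_density d n A \<psi> = reduced_op d n A (\<lambda>u v. \<psi> u * cnj (\<psi> v))"

definition norm2 :: "nat \<Rightarrow> nat \<Rightarrow> ((nat \<Rightarrow> nat) \<Rightarrow> complex) \<Rightarrow> real" where
  "norm2 d n \<psi> = (\<Sum>u\<in>configs d {..<n}. (cmod (\<psi> u))\<^sup>2)"

definition purity2 :: "nat \<Rightarrow> nat \<Rightarrow> nat set \<Rightarrow> ((nat \<Rightarrow> nat) \<Rightarrow> complex) \<Rightarrow> real" where
  "purity2 d n A \<psi> = (\<Sum>x\<in>configs d A. \<Sum>y\<in>configs d A. (cmod (unnormalized_density d n A \<psi> x y))\<^sup>2)"

lemma sq_norm_state_eq: "sq_norm_state d n \<psi> = of_real (norm2 d n \<psi>)"
  unfolding sq_norm_state_def norm2_def of_real_sum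
  by (intro sum.cong refl) (simp only: complex_norm_square mult.commute)

lemma unnormalized_density_eq:
  "unnormalized_density d n A \<psi> x y
    = (\<Sum>z\<in>configs d ({..<n} - A). \<psi> (merge A ({..<n} - A) (x, z)) * cnj (\<psi> (merge A ({..<n} - A) (y, z))))"
  by (simp only: unnormalized_density_def reduced_op_def Let_def)

lemma unnormalized_density_hermitian: "unnormalized_density d n A \<psi> y x = cnj (unnormalized_density d n A \<psi> x y)"
  unfolding unnormalized_density_eq cnj_sum
  by (intro sum.cong refl) (simp only: complex_cnj_mult complex_cnj_cnj mult.commute)

lemma trace_square_unnormalized: "trace_square d A (unnormalized_density d n A \<psi>) = of_real (purity2 d n A \<psi>)"
  unfolding trace_square_def purity2_def of_real_sum complex_norm_square
  by (intro sum.cong refl) (subst unnormalized_density_hermitian, rule refl)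

text \<open>With u = (x, z) and v = (y, w) split along A, the glued labels are (y, z) and (x, w).
  The sums over z and w then produce the entries (x, y) and (y, x) of the reduced operator.\<close>

lemma purity_sum_eq:
  assumes A: "A \<subseteq> {..<n}"
  shows "purity_sum d n A \<psi> = of_real (purity2 d n A \<psi>)"
proof -
  define B where "B = {..<n} - A"
  let ?m = "merge A B" and ?CA = "configs d A" and ?CB = "configs d B"
  let ?\<rho> = "unnormalized_density d n A \<psi>"
  note g = glue_merge[OF A, folded B_def]
  have "purity_sum d n A \<psi> = (\<Sum>x\<in>?CA. \<Sum>z\<in>?CB. \<Sum>y\<in>?CA. \<Sum>w\<in>?CB.
      \<psi> (?m (x, z)) * \<psi> (?m (y, w)) * cnj (\<psi> (?m (y, z))) * cnj (\<psi> (?m (x, w))))"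
    unfolding purity_sum_def sum_configs_split[OF A, folded B_def] g by (rule refl)
  also have "\<dots> = (\<Sum>x\<in>?CA. \<Sum>y\<in>?CA. \<Sum>z\<in>?CB. \<Sum>w\<in>?CB.
      (\<psi> (?m (x, z)) * cnj (\<psi> (?m (y, z)))) * (\<psi> (?m (y, w)) * cnj (\<psi> (?m (x, w)))))"
  proof (rule sum.cong[OF refl])
    fix x
    have "(\<Sum>z\<in>?CB. \<Sum>y\<in>?CA. \<Sum>w\<in>?CB.
        \<psi> (?m (x, z)) * \<psi> (?m (y, w)) * cnj (\<psi> (?m (y, z))) * cnj (\<psi> (?m (x, w))))
      = (\<Sum>y\<in>?CA. \<Sum>z\<in>?CB. \<Sum>w\<in>?CB.
        \<psi> (?m (x, z)) * \<psi> (?m (y, w)) * cnj (\<psi> (?m (y, z))) * cnj (\<psi> (?m (x, w))))"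
      by (rule sum.swap)
    also have "\<dots> = (\<Sum>y\<in>?CA. \<Sum>z\<in>?CB. \<Sum>w\<in>?CB.
        (\<psi> (?m (x, z)) * cnj (\<psi> (?m (y, z)))) * (\<psi> (?m (y, w)) * cnj (\<psi> (?m (x, w)))))"
      by (intro sum.cong refl) (simp only: mult_ac)
    finally show "(\<Sum>z\<in>?CB. \<Sum>y\<in>?CA. \<Sum>w\<in>?CB.
        \<psi> (?m (x, z)) * \<psi> (?m (y, w)) * cnj (\<psi> (?m (y, z))) * cnj (\<psi> (?m (x, w))))
      = (\<Sum>y\<in>?CA. \<Sum>z\<in>?CB. \<Sum>w\<in>?CB.
        (\<psi> (?m (x, z)) * cnj (\<psi> (?m (y, z)))) * (\<psi> (?m (y, w)) * cnj (\<psi> (?m (x, w)))))" .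
  qed
  also have "\<dots> = trace_square d A ?\<rho>"
    unfolding trace_square_def unnormalized_density_eq[folded B_def] B_def[symmetric] sum_product ..
  finally show ?thesis unfolding trace_square_unnormalized .
qed

text \<open>Division by zero yields zero, so for the zero vector both sides vanish and the identity
  holds for every state.\<close>

lemma reduced_purity_eq:
  "reduced_purity d n A \<psi> = purity2 d n A \<psi> / (norm2 d n \<psi>)\<^sup>2"
proof -
  let ?N = "complex_of_real (norm2 d n \<psi>)"
  have "reduced_op d n A (normalized_density d n \<psi>) x y = unnormalized_density d n A \<psi> x y / ?N" for x y
    unfolding unnormalized_density_eq
    by (simp only: reduced_op_def Let_def normalized_density_def sq_norm_state_eq sum_divide_distrib)
  then have "trace_square d A (reduced_op d n A (normalized_density d n \<psi>))
      = trace_square d A (unnormalized_density d n A \<psi>) / ?N\<^sup>2"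
    unfolding trace_square_def by (simp add: sum_divide_distrib power2_eq_square)
  also have "\<dots> = complex_of_real (purity2 d n A \<psi> / (norm2 d n \<psi>)\<^sup>2)"
    by (simp add: trace_square_unnormalized)
  finally show ?thesis unfolding reduced_purity_def by (simp only: Re_complex_of_real)
qed

lemma norm2_split:
  assumes A: "A \<subseteq> {..<n}"
  shows "complex_of_real (norm2 d n \<psi>) = (\<Sum>x\<in>configs d A. unnormalized_density d n A \<psi> x x)"
  unfolding sq_norm_state_eq[symmetric] sq_norm_state_def sum_configs_split[OF A] unnormalized_density_eq
  by (intro sum.cong refl) (simp only: mult.commute)

definition density_diag :: "nat \<Rightarrow> nat \<Rightarrow> nat set \<Rightarrow> ((nat \<Rightarrow> nat) \<Rightarrow> complex) \<Rightarrow> (nat \<Rightarrow> nat) \<Rightarrow> real" where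
  "density_diag d n A \<psi> x = (\<Sum>z\<in>configs d ({..<n} - A). (cmod (\<psi> (merge A ({..<n} - A) (x, z))))\<^sup>2)"

lemma unnormalized_density_diag: "unnormalized_density d n A \<psi> x x = of_real (density_diag d n A \<psi> x)"
  unfolding unnormalized_density_eq density_diag_def of_real_sum complex_norm_square by (rule refl)

lemma norm2_eq_sum_diag:
  assumes "A \<subseteq> {..<n}"
  shows "norm2 d n \<psi> = (\<Sum>x\<in>configs d A. density_diag d n A \<psi> x)"
  using norm2_split[OF assms, of d \<psi>] unfolding unnormalized_density_diag of_real_sum[symmetric] of_real_eq_iff .

text \<open>Cauchy-Schwarz over the labels outside A bounds each entry of the reduced operator by
  diagonal ones: |rho_xy|^2 <= rho_xx rho_yy.\<close>

lemma purity2_le: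
  assumes A: "A \<subseteq> {..<n}"
  shows "purity2 d n A \<psi> \<le> (norm2 d n \<psi>)\<^sup>2"
proof -
  let ?m = "merge A ({..<n} - A)" and ?CB = "configs d ({..<n} - A)"
  have "(cmod (unnormalized_density d n A \<psi> x y))\<^sup>2 \<le> density_diag d n A \<psi> x * density_diag d n A \<psi> y" for x y
  proof -
    have "cmod (unnormalized_density d n A \<psi> x y) \<le> (\<Sum>z\<in>?CB. cmod (\<psi> (?m (x, z))) * cmod (\<psi> (?m (y, z))))"
      unfolding unnormalized_density_eq by (rule order_trans[OF norm_sum]) (simp add: norm_mult)
    then have "(cmod (unnormalized_density d n A \<psi> x y))\<^sup>2
        \<le> (\<Sum>z\<in>?CB. cmod (\<psi> (?m (x, z))) * cmod (\<psi> (?m (y, z))))\<^sup>2"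
      by (rule power_mono) simp
    also have "\<dots> \<le> density_diag d n A \<psi> x * density_diag d n A \<psi> y"
      unfolding density_diag_def by (rule Cauchy_Schwarz_ineq_sum)
    finally show ?thesis .
  qed
  then have "purity2 d n A \<psi> \<le> (\<Sum>x\<in>configs d A. \<Sum>y\<in>configs d A. density_diag d n A \<psi> x * density_diag d n A \<psi> y)"
    unfolding purity2_def by (intro sum_mono)
  also have "\<dots> = (norm2 d n \<psi>)\<^sup>2"
    unfolding norm2_eq_sum_diag[OF A] power2_eq_square sum_product by (rule refl)
  finally show ?thesis .
qed

text \<open>Cauchy-Schwarz for the d^|A| diagonal entries against the constant 1; the purity
  dominates the sum of their squares.\<close>

lemma purity2_ge:
  assumes A: "A \<subseteq> {..<n}"
  shows "(norm2 d n \<psi>)\<^sup>2 \<le> real d ^ card A * purity2 d n A \<psi>"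
proof -
  let ?CA = "configs d A"
  have fA: "finite A" using A finite_subset by blast
  have "(norm2 d n \<psi>)\<^sup>2 = (\<Sum>x\<in>?CA. 1 * density_diag d n A \<psi> x)\<^sup>2"
    by (simp add: norm2_eq_sum_diag[OF A])
  also have "\<dots> \<le> (\<Sum>x\<in>?CA. 1\<^sup>2) * (\<Sum>x\<in>?CA. (density_diag d n A \<psi> x)\<^sup>2)"
    by (rule Cauchy_Schwarz_ineq_sum)
  also have "(\<Sum>x\<in>?CA. 1\<^sup>2) = real d ^ card A"
    by (simp add: card_configs[OF fA])
  also have "(\<Sum>x\<in>?CA. (density_diag d n A \<psi> x)\<^sup>2) \<le> purity2 d n A \<psi>"
    unfolding purity2_def
  proof (rule sum_mono)
    fix x assume x: "x \<in> ?CA"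
    have "(density_diag d n A \<psi> x)\<^sup>2 = (cmod (unnormalized_density d n A \<psi> x x))\<^sup>2"
      by (simp add: unnormalized_density_diag)
    also have "\<dots> \<le> (\<Sum>y\<in>?CA. (cmod (unnormalized_density d n A \<psi> x y))\<^sup>2)"
      by (rule member_le_sum[OF x]) (simp_all add: finite_configs[OF fA])
    finally show "(density_diag d n A \<psi> x)\<^sup>2 \<le> (\<Sum>y\<in>?CA. (cmod (unnormalized_density d n A \<psi> x y))\<^sup>2)" .
  qed
  finally show ?thesis by (simp add: mult_left_mono)
qed

section \<open>The tail bound\<close>

lemma subleading_bounds:
  assumes "2 \<le> d" "1 \<le> D"
  shows "0 \<le> subleading d D" "subleading d D \<le> 1 / real d"
proof -
  have d: "1 \<le> real d ^ 2" and D: "1 \<le> real D ^ 2" using assms by (simp_all add: one_le_power)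
  have "2 \<le> real d" using assms by simp
  then have "1 < real d ^ 2 * 1" by (simp add: one_less_power)
  also have "\<dots> \<le> real d ^ 2 * real D ^ 2" using D by (intro mult_left_mono) auto
  finally have q: "0 < real d ^ 2 * real D ^ 2 - 1" by simp
  show "0 \<le> subleading d D" unfolding subleading_def using q D by simp
  have "real d ^ 2 * (real D ^ 2 - 1) \<le> real d ^ 2 * real D ^ 2 - 1"
    using d by (simp add: algebra_simps)
  then show "subleading d D \<le> 1 / real d"
    unfolding subleading_def using q assms by (simp add: field_simps power2_eq_square)
qed

lemma overlap_bound:
  assumes "2 \<le> d" "1 \<le> D"
  shows "real D ^ 2 * (real d + 1) ^ 2 / (real d * real D ^ 2 + 1) ^ 2 \<le> 4 / real D ^ 2"
proof -
  have D: "0 < real D ^ 2" using assms by simp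
  have "real D ^ 2 * (real d + 1) ^ 2 * real D ^ 2 = (real D ^ 2 * (real d + 1)) ^ 2"
    by (simp add: power2_eq_square algebra_simps)
  also have "\<dots> \<le> (2 * (real d * real D ^ 2 + 1)) ^ 2"
  proof (rule power_mono)
    \<comment> \<open>The estimate d + 1 <= 2 d is the source of the constant 4.\<close>
    have "real D ^ 2 * (real d + 1) \<le> real D ^ 2 * (2 * real d)" using assms by (intro mult_left_mono) auto
    then show "real D ^ 2 * (real d + 1) \<le> 2 * (real d * real D ^ 2 + 1)" by (simp add: algebra_simps)
  qed simp
  also have "\<dots> = 4 * (real d * real D ^ 2 + 1) ^ 2"
    by (simp only: power_mult_distrib power2_eq_square[of "2 :: real"])
  finally have "real D ^ 2 * (real d + 1) ^ 2 * real D ^ 2 \<le> 4 * (real d * real D ^ 2 + 1) ^ 2" .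
  moreover have "0 < (real d * real D ^ 2 + 1) ^ 2" using assms by (intro zero_less_power) (simp add: add_nonneg_pos)
  ultimately show ?thesis using D by (simp only: pos_divide_le_eq pos_le_divide_eq times_divide_eq_left)
qed

section \<open>Expectations and deviations of the norm and the purity\<close>

context haar_sites
begin

sublocale sites: prob_space sites
  by (rule prob_space_PiM) (rule prob_space_axioms)

lemma n_pos: "0 < n"
  using n by simp

lemma measurable_mps_state:
  "mps_state d n D \<in> measurable sites (Pi\<^sub>M (configs d {..<n}) (\<lambda>_. borel))"
proof -
  have "(\<lambda>U. mat_trace (foldr (*) (map (\<lambda>j. mps_block D (U j) (x j)) [0..<n]) (1\<^sub>m D))) \<in> borel_measurable sites"
    if x: "x \<in> configs d {..<n}" for x
  proof -
    \<comment> \<open>Measurability of an amplitude is read off from the integrability of its closed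
      sum.\<close>
    have "integrable sites (\<lambda>U. cyclic_sum n {..<D} (\<lambda>j. (\<lambda>j V p q. V $$ (x j * D + p, q)) j (U j)))"
    proof (rule cyclic_sum_integral(1)[OF n_pos])
      fix j p q assume "j < n" "p \<in> {..<D}" "q \<in> {..<D}"
      then have "x j * D + p < d * D" "q < d * D"
        using PiE_mem[OF x[unfolded configs_def], of j] by (auto intro: block_row_less bond_less)
      then show "integrable H (\<lambda>V. V $$ (x j * D + p, q))"
        by (intro integrable_bounded[where B = 1] measurable_entry unitary_entry_le_1)
    qed
    then have "(\<lambda>U. cyclic_sum n {..<D} (\<lambda>j p q. U j $$ (x j * D + p, q))) \<in> borel_measurable sites"
      by (rule borel_measurable_integrable)
    moreover have "mat_trace (foldr (*) (map (\<lambda>j. mps_block D (U j) (x j)) [0..<n]) (1\<^sub>m D))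
        = cyclic_sum n {..<D} (\<lambda>j p q. U j $$ (x j * D + p, q))" for U :: "nat \<Rightarrow> complex mat"
      using mps_state_eq[OF n_pos x, of D U] x by (simp only: mps_state_def restrict_apply if_True)
    ultimately show ?thesis by (simp only:)
  qed
  then show ?thesis unfolding mps_state_def by (rule measurable_restrict)
qed

abbreviation "N U \<equiv> norm2 d n (mps_state d n D U)"
abbreviation "P A U \<equiv> purity2 d n A (mps_state d n D U)"

lemma norm2_expectation: "integrable sites N" "(LINT U|sites. N U) = 1"
proof -
  show "integrable sites N"
    using integrable_sq_norm unfolding sq_norm_state_eq complex_of_real_integrable_eq .
  show "(LINT U|sites. N U) = 1"
    using integral_sq_norm unfolding sq_norm_state_eq integral_complex_of_real of_real_eq_1_iff .
qed

lemma purity2_expectation: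
  assumes l: "l \<le> n" and a: "a < n" and A: "A = (\<lambda>k. (a + k) mod n) ` {..<l}"
  defines "t \<equiv> real D ^ 2 * (real d + 1) ^ 2 / (real d * real D ^ 2 + 1) ^ 2"
    and "x \<equiv> subleading d D"
  shows "integrable sites (P A)"
    "(LINT U|sites. P A U) = t + (1 - t) * (x ^ l + x ^ (n - l)) + t * x ^ n"
proof -
  have sub: "A \<subseteq> {..<n}" unfolding A using n_pos by auto
  show "integrable sites (P A)"
    using integrable_purity_sum[of A] unfolding purity_sum_eq[OF sub] complex_of_real_integrable_eq .
  show "(LINT U|sites. P A U) = t + (1 - t) * (x ^ l + x ^ (n - l)) + t * x ^ n"
    using integral_purity_sum_consecutive[OF l a A]
    unfolding purity_sum_eq[OF sub] integral_complex_of_real of_real_eq_iff t_def x_def .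
qed

lemma norm2_square_expectation:
  "integrable sites (\<lambda>U. (N U)\<^sup>2)" "(LINT U|sites. (N U)\<^sup>2) = 1 + subleading d D ^ n"
proof -
  \<comment> \<open>For empty A the upper and lower bounds on the purity coincide, since d^0 =
    1.\<close>
  have eq: "(N U)\<^sup>2 = P {} U" for U
  proof (rule antisym)
    show "(N U)\<^sup>2 \<le> P {} U" using purity2_ge[of "{}" n d "mps_state d n D U"] by simp
    show "P {} U \<le> (N U)\<^sup>2" by (rule purity2_le) simp
  qed
  have e: "{} = (\<lambda>k. (0 + k) mod n) ` {..<0}" by simp
  show "integrable sites (\<lambda>U. (N U)\<^sup>2)"
    unfolding eq by (rule purity2_expectation(1)[OF le0 n_pos e])
  show "(LINT U|sites. (N U)\<^sup>2) = 1 + subleading d D ^ n"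
  proof -
    have "t + (1 - t) * (x ^ 0 + y) + t * y = 1 + y" for t x y :: real by (simp add: algebra_simps)
    then show ?thesis unfolding eq purity2_expectation(2)[OF le0 n_pos e] by (simp only: diff_zero)
  qed
qed

text \<open>Chebyshev's inequality: \<open>N\<close> has mean 1 and variance x^n, and N <= 1/2
  forces (N - 1)^2 >= 1/4.\<close>

lemma prob_norm2_small:
  "sites.prob {U \<in> space sites. N U \<le> 1 / 2} \<le> 4 * subleading d D ^ n"
proof -
  have sq: "(N U - 1)\<^sup>2 = (N U)\<^sup>2 - 2 * N U + 1" for U by (simp add: power2_eq_square algebra_simps)
  have int: "integrable sites (\<lambda>U. (N U - 1)\<^sup>2)"
    unfolding sq using norm2_expectation(1) norm2_square_expectation(1) by simp
  have "(LINT U|sites. (N U - 1)\<^sup>2) = subleading d D ^ n"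
    unfolding sq using norm2_expectation norm2_square_expectation by (simp add: sites.prob_space)
  moreover have "sites.prob {U \<in> space sites. (N U - 1)\<^sup>2 \<ge> 1 / 4} \<le> (LINT U|sites. (N U - 1)\<^sup>2) / (1 / 4)"
    by (rule integral_Markov_inequality_measure[OF int sets.top]) auto
  moreover have "sites.prob {U \<in> space sites. N U \<le> 1 / 2} \<le> sites.prob {U \<in> space sites. (N U - 1)\<^sup>2 \<ge> 1 / 4}"
  proof (rule sites.finite_measure_mono)
    have "1 / 4 \<le> (y - 1)\<^sup>2" if "y \<le> 1 / 2" for y :: real
    proof -
      have "(1 / 2)\<^sup>2 \<le> (1 - y)\<^sup>2" using that by (intro power_mono) auto
      then show ?thesis by (simp add: power2_eq_square algebra_simps)
    qed
    then show "{U \<in> space sites. N U \<le> 1 / 2} \<subseteq> {U \<in> space sites. (N U - 1)\<^sup>2 \<ge> 1 / 4}" by blast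
    show "{U \<in> space sites. (N U - 1)\<^sup>2 \<ge> 1 / 4} \<in> sites.events"
      using borel_measurable_integrable[OF int] by measurable
  qed
  ultimately show ?thesis by simp
qed

lemma prob_purity2_excess:
  assumes l: "l \<le> n" and a: "a < n" and A: "A = (\<lambda>k. (a + k) mod n) ` {..<l}"
    and nl: "real D ^ 2 \<le> real d ^ (n - l)" and c: "0 < c"
  shows "sites.prob {U \<in> space sites. P A U - (N U)\<^sup>2 / real d ^ l \<ge> c} \<le> 9 / real D ^ 2 / c"
proof -
  define t where "t = real D ^ 2 * (real d + 1) ^ 2 / (real d * real D ^ 2 + 1) ^ 2"
  define x where "x = subleading d D"
  have x: "0 \<le> x" "x \<le> 1 / real d" unfolding x_def using subleading_bounds[OF d D] by auto
  have d1: "1 \<le> real d" using d by simp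
  have x1: "x \<le> 1" using x(2) d1 by (rule_tac order_trans[OF x(2)]) simp
  have sub: "A \<subseteq> {..<n}" unfolding A using n_pos by auto
  have "inj_on (\<lambda>k. (a + k) mod n) {..<l}"
    by (rule inj_on_subset[OF bij_betw_imp_inj_on[OF bij_betw_add_mod[OF n_pos]]]) (use l in auto)
  then have card: "card A = l" unfolding A by (simp add: card_image)
  let ?X = "\<lambda>U. P A U - (N U)\<^sup>2 / real d ^ l"
  have int: "integrable sites ?X"
    using purity2_expectation(1)[OF l a A] norm2_square_expectation(1) by simp
  have "(LINT U|sites. ?X U) = t + (1 - t) * (x ^ l + x ^ (n - l)) + t * x ^ n - (1 + x ^ n) / real d ^ l"
    using purity2_expectation[OF l a A] norm2_square_expectation by (simp add: t_def x_def)
  \<comment> \<open>The term x^l is absorbed by d^(-l). What remains is at most x^(n-l) + t + t x^n,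
    whose terms are bounded by 1, 4 and 4 times D^(-2).\<close>
  also have "\<dots> \<le> 9 / real D ^ 2"
  proof -
    have t: "0 \<le> t" "t \<le> 4 / real D ^ 2" using overlap_bound[OF d D] by (simp_all add: t_def)
    have xl: "x ^ l \<le> 1 / real d ^ l" using power_mono[OF x(2,1), of l] by (simp add: power_divide)
    have "x ^ (n - l) \<le> 1 / real d ^ (n - l)" using power_mono[OF x(2,1), of "n - l"] by (simp add: power_divide)
    also have "\<dots> \<le> 1 / real D ^ 2" using nl D d by (intro divide_left_mono mult_pos_pos zero_less_power) auto
    finally have xn: "x ^ (n - l) \<le> 1 / real D ^ 2" .
    have p: "0 \<le> x ^ k" "x ^ k \<le> 1" for k using x(1) x1 by (simp_all add: power_le_one)
    have "t * x ^ n \<le> t * 1" using t(1) p by (intro mult_left_mono)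
    moreover have "0 \<le> t * (x ^ l + x ^ (n - l))" using t(1) p by (intro mult_nonneg_nonneg add_nonneg_nonneg)
    moreover have "0 \<le> x ^ n / real d ^ l" using p d1 by (intro divide_nonneg_nonneg) auto
    moreover have "(1 - t) * (x ^ l + x ^ (n - l)) = x ^ l + x ^ (n - l) - t * (x ^ l + x ^ (n - l))"
      by (simp add: left_diff_distrib)
    moreover have "(1 + x ^ n) / real d ^ l = 1 / real d ^ l + x ^ n / real d ^ l" by (rule add_divide_distrib)
    moreover have "9 / real D ^ 2 = 9 * (1 / real D ^ 2)" "4 / real D ^ 2 = 4 * (1 / real D ^ 2)" by simp_all
    ultimately show ?thesis using t xl xn by linarith
  qed
  finally have E: "(LINT U|sites. ?X U) \<le> 9 / real D ^ 2" .
  have pos: "0 \<le> ?X U" for U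
    using purity2_ge[OF sub, of d "mps_state d n D U"] d1 by (simp add: card field_simps)
  have "sites.prob {U \<in> space sites. ?X U \<ge> c} \<le> (LINT U|sites. ?X U) / c"
    by (rule integral_Markov_inequality_measure[OF int sets.top _ c]) (intro AE_I2 pos)
  also have "\<dots> \<le> 9 / real D ^ 2 / c" using E c by (intro divide_right_mono) auto
  finally show ?thesis .
qed

lemma rmps_purity_tail:
  fixes r :: real
  assumes l: "l \<le> n" and A: "consecutive_sites n l A"
    and nl: "real n \<ge> 2 * (ln (real D) / ln (real d)) + real l"
  shows "measure (rmps H d n D)
      {\<psi> \<in> space (rmps H d n D). reduced_purity d n A \<psi> \<ge> real D powr (- r) + real d powr (- real l)}
    \<le> 40 * real D powr (- (2 - r))" (is "measure _ ?S \<le> _")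
proof -
  obtain a where a: "a < n" "A = (\<lambda>k. (a + k) mod n) ` {..<l}" using A unfolding consecutive_sites_def by blast
  have sub: "A \<subseteq> {..<n}" unfolding a(2) using n_pos by auto
  have D1: "1 \<le> real D" and d2: "2 \<le> real d" using d D by simp_all
  have dl: "real d powr (- real l) = 1 / real d ^ l" using d2 by (simp add: powr_minus powr_realpow divide_inverse)
  show ?thesis
  \<comment> \<open>By convention \<open>measure\<close> is 0 on sets outside the sigma-algebra, so
    that case is trivial; the other degenerate case is negative \<open>r\<close>.\<close>
  proof (cases "?S \<in> sets (rmps H d n D) \<and> 0 \<le> r")
    case False
    have "measure (rmps H d n D) ?S = 0"
    proof (cases "?S \<in> sets (rmps H d n D)")
      case True
      then have "\<not> 0 \<le> r" using False by blast
      then have r: "r < 0" by (simp only: not_le)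
      have "reduced_purity d n A \<psi> < real D powr (- r) + real d powr (- real l)" for \<psi>
      proof -
        have "reduced_purity d n A \<psi> \<le> 1"
          unfolding reduced_purity_eq using purity2_le[OF sub, of d \<psi>] by (simp add: divide_le_eq_1)
        also have "1 \<le> real D powr (- r)" using r D1 by (intro ge_one_powr_ge_zero) auto
        also have "\<dots> < real D powr (- r) + real d powr (- real l)" using d2 by simp
        finally show ?thesis .
      qed
      then have "?S = {}" by (simp only: not_le[symmetric] simp_thms Collect_empty_eq)
      then show ?thesis by (simp only: measure_empty)
    qed (rule measure_notin_sets)
    then show ?thesis by (simp only:) simp
  next
    case True
    \<comment> \<open>The quarter is the lower bound for N^2 on the event N > 1/2.\<close>
    define c where "c = real D powr (- r) / 4"
    have c: "0 < c" using D1 by (simp add: c_def)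
    \<comment> \<open>The logarithmic condition on \<open>n\<close> is brought into the form D^2 <=
      d^(n-l) used by the moment estimates.\<close>
    have "2 * ln (real D) \<le> (real n - real l) * ln (real d)"
      using nl d2 by (simp add: field_simps)
    then have "ln (real D ^ 2) \<le> ln (real d ^ (n - l))"
      using l D1 d2 by (simp add: ln_realpow of_nat_diff)
    then have nl': "real D ^ 2 \<le> real d ^ (n - l)"
      using D1 d2 by (subst (asm) ln_le_cancel_iff) auto
    let ?E1 = "{U \<in> space sites. N U \<le> 1 / 2}"
    let ?E2 = "{U \<in> space sites. P A U - (N U)\<^sup>2 / real d ^ l \<ge> c}"
    have ev1: "?E1 \<in> sites.events"
      using borel_measurable_integrable[OF norm2_expectation(1)] by measurable
    have ev2: "?E2 \<in> sites.events"
      using borel_measurable_integrable[OF norm2_square_expectation(1)]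
        borel_measurable_integrable[OF purity2_expectation(1)[OF l a]] by measurable
    have "measure (rmps H d n D) ?S = sites.prob (mps_state d n D -` ?S \<inter> space sites)"
      unfolding rmps_def using True unfolding rmps_def
      by (intro measure_distr measurable_mps_state) (simp only: sets_distr)
    also have "\<dots> \<le> sites.prob (?E1 \<union> ?E2)"
    proof (rule sites.finite_measure_mono)
      show "mps_state d n D -` ?S \<inter> space sites \<subseteq> ?E1 \<union> ?E2"
      proof
        fix U assume U: "U \<in> mps_state d n D -` ?S \<inter> space sites"
        then have pur: "real D powr (- r) + 1 / real d ^ l \<le> P A U / (N U)\<^sup>2"
          unfolding dl[symmetric] reduced_purity_eq[symmetric] by blast
        show "U \<in> ?E1 \<union> ?E2"
        proof (cases "N U \<le> 1 / 2")
          case True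
          then show ?thesis using U by blast
        next
          case False
          then have N: "1 / 2 < N U" by simp
          then have "(1 / 2)\<^sup>2 \<le> (N U)\<^sup>2" by (intro power_mono) auto
          then have N2: "1 / 4 \<le> (N U)\<^sup>2" by (simp add: power2_eq_square)
          have "(real D powr (- r) + 1 / real d ^ l) * (N U)\<^sup>2 \<le> P A U"
            using pur N by (simp add: pos_le_divide_eq)
          moreover have "real D powr (- r) * (1 / 4) \<le> real D powr (- r) * (N U)\<^sup>2"
            by (rule mult_left_mono[OF N2]) simp
          ultimately have "c \<le> P A U - (N U)\<^sup>2 / real d ^ l"
            unfolding c_def by (simp add: distrib_right)
          then show ?thesis using U by blast
        qed
      qed
      show "?E1 \<union> ?E2 \<in> sites.events" using ev1 ev2 by (rule sets.Un)
    qed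
    also have "\<dots> \<le> sites.prob ?E1 + sites.prob ?E2"
      by (rule measure_Un_le[OF ev1 ev2])
    also have "\<dots> \<le> 4 / real D ^ 2 + 9 / real D ^ 2 / c"
    proof (rule add_mono)
      have "subleading d D ^ n \<le> (1 / real d) ^ n"
        using subleading_bounds[OF d D] by (intro power_mono)
      also have "\<dots> = 1 / real d ^ n" by (simp add: power_divide)
      also have "\<dots> \<le> 1 / real D ^ 2"
      proof (rule divide_left_mono)
        have "real d ^ (n - l) \<le> real d ^ n" using d2 by (intro power_increasing) auto
        then show "real D ^ 2 \<le> real d ^ n" using nl' by simp
      qed (use D1 d2 in auto)
      finally show "sites.prob ?E1 \<le> 4 / real D ^ 2" using prob_norm2_small by simp
      show "sites.prob ?E2 \<le> 9 / real D ^ 2 / c" by (rule prob_purity2_excess[OF l a nl' c])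
    qed
    \<comment> \<open>Dividing by c = D^(-r) / 4 turns 9 into 36, and r >= 0 gives D^(-2) <=
      D^(-(2-r)) for the norm term; hence 40 = 4 + 36.\<close>
    also have "\<dots> \<le> 40 * real D powr (- (2 - r))"
    proof -
      have D2: "1 / real D ^ 2 = real D powr (- 2)"
        using D1 by (simp add: powr_minus powr_numeral divide_inverse)
      have "real D powr (- 2) \<le> real D powr (- (2 - r))" using conjunct2[OF True] D1 by (intro powr_mono) auto
      then have "4 * (1 / real D ^ 2) \<le> 4 * real D powr (- (2 - r))" unfolding D2 by simp
      moreover have "9 / real D ^ 2 / c = 36 * (real D powr (- 2) * real D powr r)"
        unfolding D2[symmetric] c_def using D1 by (simp add: powr_minus field_simps)
      moreover have "real D powr (- 2) * real D powr r = real D powr (- (2 - r))"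
        by (simp add: powr_add[symmetric])
      ultimately show ?thesis by simp
    qed
    finally show ?thesis .
  qed
qed

end

theorem theorem3:
  fixes r :: real
  shows "\<exists>C1>0. \<exists>C2>0. \<forall>(d::nat) (D::nat) (l::nat) (n::nat) (H::complex mat measure) (A::nat set).
    d \<ge> 2 \<longrightarrow> D \<ge> 1 \<longrightarrow> 1 \<le> l \<longrightarrow> l \<le> n \<longrightarrow>
    real n \<ge> 2 * (ln (real D) / ln (real d)) + real l \<longrightarrow>
    haar_unitary (d * D) H \<longrightarrow> consecutive_sites n l A \<longrightarrow>
    measure (rmps H d n D)
      {\<psi> \<in> space (rmps H d n D).
         reduced_purity d n A \<psi> \<ge> C1 * real D powr (- r) + real d powr (- real l)}
    \<le> C2 * real D powr (- (2 - r))"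
proof -
  have tail: "measure (rmps H d n D) {\<psi> \<in> space (rmps H d n D).
      reduced_purity d n A \<psi> \<ge> 1 * real D powr (- r) + real d powr (- real l)} \<le> 40 * real D powr (- (2 - r))"
    if *: "d \<ge> 2" "D \<ge> 1" "1 \<le> l" "l \<le> n" "real n \<ge> 2 * (ln (real D) / ln (real d)) + real l"
      "haar_unitary (d * D) H" "consecutive_sites n l A" for d D l n H A
  proof -
    interpret haar_sites d D H n
      using * by unfold_locales auto
    show ?thesis
      unfolding mult_1_left by (rule rmps_purity_tail[OF *(4,7,5)])
  qed
  show ?thesis
    by (rule exI[where x = "1 :: real"], rule conjI, simp, rule exI[where x = "40 :: real"], rule conjI,
        simp, intro allI impI, rule tail)
qed

end
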